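(* Let $P$ be a finite poset. Then there exists a constant $C_P$ (depending only on $P$) with the following property. Let $k$ and $n$ be positive integers with $n \ge \dim P$, and let $w$ be the width of the grid $[k]^n$. If $S \subseteq [k]^n$ does not contain a copy of $P$, then $|S| \le C_P\, w$.
   Context: For a positive integer $k$, $[k]=\{1,\dots,k\}$. The grid $[k]^n$ is the set of $n$-tuples with entries in $[k]$, ordered pointwise: $(x_1,\dots,x_n)\le(y_1,\dots,y_n)$ iff $x_i\le y_i$ for all $i\in[n]$. If $P,Q$ are posets, a subset $P'\subseteq Q$ is a copy of $P$ if the subposet of $Q$ induced on $P'$ is isomorphic to $P$. The width $w(Q)$ of a poset $Q$ is the size of its largest antichain. The (Dushnik–Miller) dimension $\dim P$ is the smallest positive integer $d$ for which there exist bijections $L_1,\dots,L_d:P\to[|P|]$ such that for all $p,q\in P$, $p\le_P q$ iff $L_i(p)\le L_i(q)$ for every $i\in[d]$. *)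

theory Defs
  imports Complex_Main
begin

definition poset_on :: "'a set \<Rightarrow> ('a \<Rightarrow> 'a \<Rightarrow> bool) \<Rightarrow> bool" where
  "poset_on X le \<longleftrightarrow>
     (\<forall>x\<in>X. le x x) \<and>
     (\<forall>x\<in>X. \<forall>y\<in>X. le x y \<and> le y x \<longrightarrow> x = y) \<and>
     (\<forall>x\<in>X. \<forall>y\<in>X. \<forall>z\<in>X. le x y \<and> le y z \<longrightarrow> le x z)"

definition grid :: "nat \<Rightarrow> nat \<Rightarrow> nat list set" where
  "grid k n = {xs. length xs = n \<and> set xs \<subseteq> {1..k}}"

definition grid_le :: "nat list \<Rightarrow> nat list \<Rightarrow> bool" where
  "grid_le xs ys \<longleftrightarrow> list_all2 (\<le>) xs ys"

definition antichain_in :: "'b set \<Rightarrow> ('b \<Rightarrow> 'b \<Rightarrow> bool) \<Rightarrow> 'b set \<Rightarrow> bool" where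
  "antichain_in Q le A \<longleftrightarrow> A \<subseteq> Q \<and> (\<forall>x\<in>A. \<forall>y\<in>A. x \<noteq> y \<longrightarrow> \<not> le x y)"

definition width :: "'b set \<Rightarrow> ('b \<Rightarrow> 'b \<Rightarrow> bool) \<Rightarrow> nat" where
  "width Q le = Max {card A | A. antichain_in Q le A}"

definition is_copy :: "'a set \<Rightarrow> ('a \<Rightarrow> 'a \<Rightarrow> bool) \<Rightarrow> 'b set \<Rightarrow> ('b \<Rightarrow> 'b \<Rightarrow> bool) \<Rightarrow> 'b set \<Rightarrow> bool" where
  "is_copy X le Q leQ P' \<longleftrightarrow> P' \<subseteq> Q \<and>
     (\<exists>f. bij_betw f X P' \<and> (\<forall>x\<in>X. \<forall>y\<in>X. le x y \<longleftrightarrow> leQ (f x) (f y)))"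

definition realizer :: "'a set \<Rightarrow> ('a \<Rightarrow> 'a \<Rightarrow> bool) \<Rightarrow> nat \<Rightarrow> bool" where
  "realizer X le d \<longleftrightarrow> (\<exists>L :: nat \<Rightarrow> 'a \<Rightarrow> nat.
      (\<forall>i<d. bij_betw (L i) X {1..card X}) \<and>
      (\<forall>p\<in>X. \<forall>q\<in>X. le p q \<longleftrightarrow> (\<forall>i<d. L i p \<le> L i q)))"

definition poset_dim :: "'a set \<Rightarrow> ('a \<Rightarrow> 'a \<Rightarrow> bool) \<Rightarrow> nat" where
  "poset_dim X le = (LEAST d. d \<ge> 1 \<and> realizer X le d)"

end

theory Submission
  imports Defs "HOL-Library.FuncSet"
begin

text \<open>A realizer of size \<open>d = dim P\<close> turns \<open>P\<close> into a pattern of points no two of which share a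
  coordinate. By the block argument of Marcus--Tardos and Klazar--Marcus, a subset of a
  \<open>d\<close>-dimensional box avoiding this pattern has at most a constant times the sum of the sizes of
  the \<open>d\<close> coordinate facets of the box. Split \<open>[k]^n\<close> into \<open>d\<close> factors \<open>[k]^m\<close> with \<open>m\<close> about
  \<open>n / d\<close>, and each factor into symmetric chains: this makes \<open>[k]^n\<close> a disjoint union of
  \<open>d\<close>-dimensional boxes. Summing the bound over them leaves, for each factor, its number of chains
  times \<open>k^(n - m)\<close>. The number of chains is at most the size of the middle layer, which is
  \<open>O(k^(m - 1) / sqrt m)\<close> by a Littlewood--Offord argument, while by Chebyshev's inequality the
  width of \<open>[k]^n\<close> is at least of order \<open>k^(n - 1) / sqrt n\<close>.\<close>

text \<open>The obstacle is uniformity in both \<open>k\<close> and \<open>n\<close>. The constant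
  of the block argument depends on the dimension of the box, so it cannot be applied to
  \<open>[k]^n\<close> directly; it is applied in the fixed dimension \<open>d\<close>, with chains
  in the role of coordinate axes. A pattern found in such a box is a copy of \<open>P\<close>,
  because distinct elements of \<open>P\<close> occupy distinct positions in each linear order of
  the realizer, so strict inequalities along every axis determine all comparisons. The condition
  \<open>n \<ge> d\<close> gives every factor at least one coordinate, and
  \<open>n \<le> 2 * d * m\<close> then costs only a factor \<open>sqrt (2 * d)\<close> when
  \<open>sqrt m\<close> is replaced by \<open>sqrt n\<close>. Symmetric chains serve twice: their
  number is bounded by a middle layer, and for \<open>k = 2\<close> they yield the Sperner theorem
  behind the Littlewood-Offord estimate. That estimate needs two distinct values per coordinate, so
  \<open>k = 1\<close> is treated separately.\<close>

lemma card_le_fibres: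
  assumes "finite A" "finite T" "g ` A \<subseteq> T"
    and "\<And>t. t \<in> T \<Longrightarrow> card {x \<in> A. g x = t} \<le> c"
  shows "card A \<le> card T * c"
proof -
  have "A = (\<Union>t\<in>T. {x \<in> A. g x = t})"
    using assms(3) by auto
  then have "card A \<le> (\<Sum>t\<in>T. card {x \<in> A. g x = t})"
    using card_UN_le[OF assms(2), of "\<lambda>t. {x \<in> A. g x = t}"] by simp
  also have "\<dots> \<le> card T * c"
    using sum_bounded_above[of T "\<lambda>t. card {x \<in> A. g x = t}" c] assms(4) by simp
  finally show ?thesis .
qed

section \<open>Realizers\<close>

lemma bij_betw_rank:
  fixes key :: "'a \<Rightarrow> nat"
  assumes "finite X" "inj_on key X"
  shows "bij_betw (\<lambda>x. card {z \<in> X. key z \<le> key x}) X {1..card X}"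
    and "\<And>x y. y \<in> X \<Longrightarrow> key x < key y \<Longrightarrow>
           card {z \<in> X. key z \<le> key x} < card {z \<in> X. key z \<le> key y}"
proof -
  let ?r = "\<lambda>x. card {z \<in> X. key z \<le> key x}"
  show mono: "?r x < ?r y" if "y \<in> X" "key x < key y" for x y
  proof (rule psubset_card_mono)
    show "finite {z \<in> X. key z \<le> key y}" using assms by simp
    show "{z \<in> X. key z \<le> key x} \<subset> {z \<in> X. key z \<le> key y}"
      using that by force
  qed
  have inj: "inj_on ?r X"
  proof (rule inj_onI)
    fix x y assume xy: "x \<in> X" "y \<in> X" "?r x = ?r y"
    then have "key x = key y" using mono[of y x] mono[of x y] by (cases "key x" "key y" rule: linorder_cases) auto
    then show "x = y" using assms(2) xy by (auto dest: inj_onD)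
  qed
  have "?r x \<in> {1..card X}" if "x \<in> X" for x
  proof -
    have "{z \<in> X. key z \<le> key x} \<noteq> {}" using that by auto
    then have "?r x > 0" using assms by (simp add: card_gt_0_iff)
    moreover have "?r x \<le> card X" using assms by (intro card_mono) auto
    ultimately show ?thesis by simp
  qed
  then have sub: "?r ` X \<subseteq> {1..card X}" by blast
  have "card (?r ` X) = card {1..card X}" using card_image[OF inj] by simp
  with sub have "?r ` X = {1..card X}" by (intro card_subset_eq) auto
  with inj show "bij_betw ?r X {1..card X}" by (simp add: bij_betw_def)
qed

text \<open>Since \<open>p\<close> is not below \<open>q\<close>, the element \<open>q\<close> lies
  outside the up-set of \<open>p\<close>. The size of a principal down-set is strictly increasing
  along \<open>le\<close> and at most \<open>card X\<close>, so adding \<open>card X + 1\<close> on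
  that up-set keeps monotonicity and puts \<open>p\<close> after \<open>q\<close>.\<close>

lemma linear_extension_reversing:
  assumes fin: "finite X" and po: "poset_on X le"
    and p: "p \<in> X" and q: "q \<in> X" and npq: "\<not> le p q"
  obtains L where "bij_betw L X {1..card X}"
    "\<And>x y. x \<in> X \<Longrightarrow> y \<in> X \<Longrightarrow> le x y \<Longrightarrow> L x \<le> (L y :: nat)" "L q < L p"
proof -
  define N where "N = card X"
  obtain e where e: "bij_betw e X {0..<N}"
    using ex_bij_betw_finite_nat[OF fin] N_def by blast
  have eN: "e x < N" if "x \<in> X" for x
    using e that by (auto simp: bij_betw_def)
  \<comment> \<open>The up-set of \<open>p\<close> is lifted above everything else.\<close>
  define h where "h x = (if le p x then N + 1 else 0) + card {z \<in> X. le z x}" for x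
  \<comment> \<open>Lexicographic order on \<open>(h x, e x)\<close> as a single number, since
    \<open>e x < N\<close>; the enumeration \<open>e\<close> breaks ties.\<close>
  define key where "key x = h x * N + e x" for x
  have key_less: "key x < key y" if "h x < h y" "x \<in> X" for x y
  proof -
    have "key x < (h x + 1) * N" using eN[OF that(2)] by (simp add: key_def)
    also have "\<dots> \<le> h y * N" using that(1) by (intro mult_right_mono) auto
    finally show ?thesis by (simp add: key_def)
  qed
  have key_inj: "inj_on key X"
  proof (rule inj_onI)
    fix x y assume xy: "x \<in> X" "y \<in> X" "key x = key y"
    then have "h x = h y" using key_less by (metis less_irrefl linorder_neqE_nat)
    with xy have "e x = e y" by (simp add: key_def)
    with xy e show "x = y" by (auto simp: bij_betw_def inj_on_def)
  qed
  have po_refl: "le x x" if "x \<in> X" for x using po that by (simp add: poset_on_def)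
  have po_trans: "le x z" if "x \<in> X" "y \<in> X" "z \<in> X" "le x y" "le y z" for x y z
    using po that unfolding poset_on_def by metis
  have h_mono: "h x < h y" if "x \<in> X" "y \<in> X" "le x y" "x \<noteq> y" for x y
  proof -
    have "card {z \<in> X. le z x} < card {z \<in> X. le z y}"
    proof (rule psubset_card_mono)
      show "finite {z \<in> X. le z y}" using fin by simp
      have "y \<in> {z \<in> X. le z y} - {z \<in> X. le z x}"
        using that po po_refl unfolding poset_on_def by blast
      moreover have "{z \<in> X. le z x} \<subseteq> {z \<in> X. le z y}"
        using that po_trans by blast
      ultimately show "{z \<in> X. le z x} \<subset> {z \<in> X. le z y}" by blast
    qed
    moreover have "le p x \<longrightarrow> le p y" using that p po_trans by blast
    ultimately show ?thesis by (auto simp: h_def)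
  qed
  have "card {z \<in> X. le z q} \<le> N"
    unfolding N_def using fin by (intro card_mono) auto
  moreover have "le p p" using p by (rule po_refl)
  ultimately have "h q < h p" using npq by (simp add: h_def)
  then have qp: "key q < key p" using key_less q by blast
  define L where "L x = card {z \<in> X. key z \<le> key x}" for x
  have "bij_betw L X {1..card X}"
    using bij_betw_rank(1)[OF fin key_inj] unfolding L_def by simp
  moreover have "L x \<le> L y" if "x \<in> X" "y \<in> X" "le x y" for x y
  proof (cases "x = y")
    case False
    then have "key x < key y" using key_less[OF h_mono] that by blast
    then show ?thesis
      using bij_betw_rank(2)[OF fin key_inj that(2)] unfolding L_def by (intro less_imp_le)
  qed simp
  moreover have "L q < L p"
    using bij_betw_rank(2)[OF fin key_inj p qp] unfolding L_def .
  ultimately show ?thesis using that by blast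
qed

text \<open>Makes the \<open>LEAST\<close> in \<open>poset_dim\<close> attained. One linear
  extension is taken for each pair with \<open>\<not> le p q\<close>, chosen to violate that
  comparison. If there is no such pair, antisymmetry leaves at most one element, and a single order
  realizes the poset.\<close>

lemma ex_realizer:
  assumes fin: "finite X" and po: "poset_on X le"
  shows "\<exists>d\<ge>1. realizer X le d"
proof (cases "X = {}")
  case True
  then have "realizer X le 1" by (auto simp: realizer_def bij_betw_def)
  then show ?thesis by blast
next
  case ne: False
  define R where "R = {pq \<in> X \<times> X. \<not> le (fst pq) (snd pq)}"
  have R: "finite R" using fin by (simp add: R_def)
  have "\<exists>L::'a \<Rightarrow> nat. bij_betw L X {1..card X} \<and>
      (\<forall>x\<in>X. \<forall>y\<in>X. le x y \<longrightarrow> L x \<le> L y) \<and> L (snd pq) < L (fst pq)" if "pq \<in> R" for pq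
  proof -
    from that have *: "fst pq \<in> X" "snd pq \<in> X" "\<not> le (fst pq) (snd pq)"
      by (auto simp: R_def)
    show ?thesis by (rule linear_extension_reversing[OF fin po *]) blast
  qed
  then obtain M :: "'a \<times> 'a \<Rightarrow> 'a \<Rightarrow> nat" where M: "\<And>pq. pq \<in> R \<Longrightarrow>
      bij_betw (M pq) X {1..card X} \<and> (\<forall>x\<in>X. \<forall>y\<in>X. le x y \<longrightarrow> M pq x \<le> M pq y) \<and>
      M pq (snd pq) < M pq (fst pq)"
    by metis
  show ?thesis
  proof (cases "R = {}")
    case True
    then have all: "le x y" if "x \<in> X" "y \<in> X" for x y using that by (auto simp: R_def)
    then have eq: "x = y" if "x \<in> X" "y \<in> X" for x y
      using that po by (auto simp: poset_on_def)
    obtain a where a: "X = {a}" using ne eq by blast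
    have "realizer X le 1"
      unfolding realizer_def using all by (intro exI[of _ "\<lambda>i x. 1"]) (auto simp: a bij_betw_def)
    then show ?thesis by blast
  next
    case False
    obtain r where r: "bij_betw r {0..<card R} R"
      using ex_bij_betw_nat_finite[OF R] by blast
    have rR: "r i \<in> R" if "i < card R" for i
      using r that by (auto simp: bij_betw_def)
    have "realizer X le (card R)"
      unfolding realizer_def
    proof (intro exI[of _ "\<lambda>i. M (r i)"] conjI allI impI ballI)
      fix i assume "i < card R"
      then show "bij_betw (M (r i)) X {1..card X}" using M rR by blast
    next
      fix p q assume pq: "p \<in> X" "q \<in> X"
      show "le p q \<longleftrightarrow> (\<forall>i<card R. M (r i) p \<le> M (r i) q)"
      proof
        assume "le p q"
        then show "\<forall>i<card R. M (r i) p \<le> M (r i) q" using M rR pq by blast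
      next
        assume *: "\<forall>i<card R. M (r i) p \<le> M (r i) q"
        show "le p q"
        proof (rule ccontr)
          assume "\<not> le p q"
          then have "(p, q) \<in> R" using pq by (simp add: R_def)
          then obtain i where "i < card R" "r i = (p, q)"
            using r unfolding bij_betw_def by (metis imageE atLeastLessThan_iff)
          then show False using * M rR by fastforce
        qed
      qed
    qed
    moreover have "card R \<ge> 1" using False R by (simp add: Suc_le_eq card_gt_0_iff)
    ultimately show ?thesis by blast
  qed
qed

lemma poset_dim_realizer:
  assumes "finite X" "poset_on X le"
  shows "poset_dim X le \<ge> 1" "realizer X le (poset_dim X le)"
proof -
  have "poset_dim X le \<ge> 1 \<and> realizer X le (poset_dim X le)"
    unfolding poset_dim_def by (rule LeastI_ex) (use ex_realizer[OF assms] in blast)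
  then show "poset_dim X le \<ge> 1" "realizer X le (poset_dim X le)" by auto
qed

section \<open>Pattern-avoiding subsets of boxes\<close>

text \<open>The pattern is a multidimensional permutation matrix with one point
  \<open>(L i p)\<close> for each \<open>p\<close>. Strict implications suffice: when
  \<open>L i\<close> is injective on \<open>X\<close>, they force coordinate \<open>i\<close> of
  \<open>f\<close> to reproduce the linear order \<open>L i\<close> exactly. The index set is a
  parameter because the dimension induction deletes coordinates.\<close>

definition contains_pattern :: "'a set \<Rightarrow> ('i \<Rightarrow> 'a \<Rightarrow> nat) \<Rightarrow> 'i set \<Rightarrow> ('i \<Rightarrow> nat) set \<Rightarrow> bool" where
  "contains_pattern X L I A \<longleftrightarrow>
     (\<exists>f. f ` X \<subseteq> A \<and> (\<forall>i\<in>I. \<forall>p\<in>X. \<forall>q\<in>X. L i p < L i q \<longrightarrow> f p i < f q i))"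

lemma contains_patternI:
  assumes "\<And>p. p \<in> X \<Longrightarrow> f p \<in> A"
    and "\<And>i p q. i \<in> I \<Longrightarrow> p \<in> X \<Longrightarrow> q \<in> X \<Longrightarrow> L i p < L i q \<Longrightarrow> f p i < f q i"
  shows "contains_pattern X L I A"
  unfolding contains_pattern_def using assms by (intro exI[of _ f]) auto

lemma contains_patternE:
  assumes "contains_pattern X L I A"
  obtains f where "\<forall>p\<in>X. f p \<in> A"
    "\<forall>i\<in>I. \<forall>p\<in>X. \<forall>q\<in>X. L i p < L i q \<longrightarrow> f p i < f q i"
  using assms unfolding contains_pattern_def image_subset_iff by (elim exE conjE)

lemma image_choiceE:
  assumes "\<forall>p\<in>X. f p \<in> h ` A"
  obtains g where "\<And>p. p \<in> X \<Longrightarrow> g p \<in> A" "\<And>p. p \<in> X \<Longrightarrow> f p = h (g p)"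
proof -
  have "\<forall>p\<in>X. \<exists>x. x \<in> A \<and> f p = h x" using assms unfolding image_iff Bex_def .
  from bchoice[OF this] show ?thesis using that by blast
qed

lemma ex_order_copy:
  fixes K :: "nat set" and l :: "'a \<Rightarrow> nat"
  assumes "finite K" "card X \<le> card K" "bij_betw l X {1..card X}"
  obtains g where "g ` X \<subseteq> K" "\<And>p q. p \<in> X \<Longrightarrow> q \<in> X \<Longrightarrow> l p < l q \<Longrightarrow> g p < g q"
proof
  let ?xs = "sorted_list_of_set K"
  \<comment> \<open>The element of rank \<open>l p\<close> in \<open>K\<close>; ranks start at 1,
    list positions at 0.\<close>
  let ?g = "\<lambda>p. ?xs ! (l p - 1)"
  have l: "1 \<le> l p \<and> l p \<le> card X" if "p \<in> X" for p
    using assms(3) that by (auto simp: bij_betw_def)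
  show "?g ` X \<subseteq> K"
  proof
    fix y assume "y \<in> ?g ` X"
    then obtain p where p: "p \<in> X" "y = ?g p" by blast
    then have "l p - 1 < length ?xs"
      using l[OF p(1)] assms(2) by (simp only: length_sorted_list_of_set) linarith
    then show "y \<in> K"
      using p(2) nth_mem[of "l p - 1" ?xs] by (simp add: set_sorted_list_of_set[OF assms(1)])
  qed
  show "?g p < ?g q" if "p \<in> X" "q \<in> X" "l p < l q" for p q
    using l[OF that(1)] l[OF that(2)] that(3) assms
    by (intro sorted_wrt_nth_less[OF strict_sorted_list_of_set]) auto
qed

text \<open>Base of the dimension induction: on a line, any \<open>card X\<close> distinct values
  already carry the pattern.\<close>

lemma avoiding_power_cube_1:
  fixes A :: "('i \<Rightarrow> nat) set"
  assumes "finite X" "bij_betw (L i) X {1..card X}"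
    and A: "A \<subseteq> PiE {i} (\<lambda>_. {..<N})" and av: "\<not> contains_pattern X L {i} A"
  shows "card A \<le> card X"
proof (rule ccontr)
  assume "\<not> card A \<le> card X"
  have fin: "finite A" by (rule finite_subset[OF A]) (intro finite_PiE, auto)
  have inj: "inj_on (\<lambda>x. x i) A"
  proof (rule inj_onI)
    fix x y assume "x \<in> A" "y \<in> A" "x i = y i"
    then show "x = y" using A by (intro PiE_ext[of x "{i}" "\<lambda>_. {..<N}" y]) auto
  qed
  have "card X \<le> card ((\<lambda>x. x i) ` A)"
    using \<open>\<not> card A \<le> card X\<close> card_image[OF inj] by simp
  then obtain g where g: "g ` X \<subseteq> (\<lambda>x. x i) ` A"
      "\<And>p q. p \<in> X \<Longrightarrow> q \<in> X \<Longrightarrow> L i p < L i q \<Longrightarrow> g p < g q"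
    using ex_order_copy[of "(\<lambda>x. x i) ` A" X "L i"] fin assms(2) by blast
  have "\<forall>p\<in>X. \<exists>x. x \<in> A \<and> x i = g p" using g(1) by (force simp: image_subset_iff)
  then obtain f where "\<forall>p\<in>X. f p \<in> A \<and> f p i = g p" by metis
  then have "contains_pattern X L {i} A"
    using g(2) by (intro contains_patternI[of X f]) auto
  with av show False by simp
qed

text \<open>Contract each cube of side \<open>s\<close> to a point. Strict inequalities between
  blocks lift to their points, so the contracted set still avoids the pattern, and at most
  \<open>b\<close> blocks are occupied. A block is wide in direction \<open>i\<close> if its points
  show at least \<open>card X\<close> values of coordinate \<open>i\<close>. A block that is wide in
  no direction holds at most \<open>card X ^ card I\<close> points, any block at most
  \<open>s ^ card I\<close>. Wide blocks are few: in one slab orthogonal to direction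
  \<open>i\<close>, those sharing the same \<open>card X\<close> values avoid the pattern with
  coordinate \<open>i\<close> deleted, since the shared values could supply the missing
  coordinate.\<close>

lemma avoiding_power_cube_step:
  fixes A :: "('i \<Rightarrow> nat) set" and L :: "'i \<Rightarrow> 'a \<Rightarrow> nat"
  assumes I: "finite I" and X: "finite X" "\<And>i. i \<in> I \<Longrightarrow> bij_betw (L i) X {1..card X}"
    and s: "s > 0"
    and A: "A \<subseteq> PiE I (\<lambda>_. {..<M * s})" and av: "\<not> contains_pattern X L I A"
    and full: "\<And>B. B \<subseteq> PiE I (\<lambda>_. {..<M}) \<Longrightarrow> \<not> contains_pattern X L I B \<Longrightarrow> card B \<le> b"
    and face: "\<And>i B. i \<in> I \<Longrightarrow> B \<subseteq> PiE (I - {i}) (\<lambda>_. {..<M}) \<Longrightarrow>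
                 \<not> contains_pattern X L (I - {i}) B \<Longrightarrow> card B \<le> c"
  shows "card A \<le> b * card X ^ card I + card I * (M * (2 ^ s * c)) * s ^ card I"
proof -
  define \<beta> where "\<beta> x = (\<lambda>i\<in>I. x i div s)" for x :: "'i \<Rightarrow> nat"
  define blk where "blk z = {x \<in> A. \<beta> x = z}" for z
  define wide where "wide i = {z \<in> \<beta> ` A. card X \<le> card ((\<lambda>x. x i) ` blk z)}" for i
  have finA: "finite A" by (rule finite_subset[OF A]) (intro finite_PiE I, auto)
  then have fblk: "finite (blk z)" for z by (simp add: blk_def)
  have \<beta>A: "\<beta> ` A \<subseteq> PiE I (\<lambda>_. {..<M})"
  proof -
    have "x i div s < M" if "x \<in> A" "i \<in> I" for x i
      using A that s by (auto simp: less_mult_imp_div_less PiE_iff subset_iff)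
    then show ?thesis by (auto simp: \<beta>_def)
  qed
  have block_less: "x i < y i" if "\<beta> x i < \<beta> y i" "i \<in> I" for x y i
    using that by (simp add: \<beta>_def) (meson div_le_mono leD leI)

  have "\<not> contains_pattern X L I (\<beta> ` A)"
  proof
    assume "contains_pattern X L I (\<beta> ` A)"
    then obtain f where f: "\<forall>p\<in>X. f p \<in> \<beta> ` A"
        "\<forall>i\<in>I. \<forall>p\<in>X. \<forall>q\<in>X. L i p < L i q \<longrightarrow> f p i < f q i"
      by (rule contains_patternE)
    from image_choiceE[OF f(1)] obtain g
      where g: "\<And>p. p \<in> X \<Longrightarrow> g p \<in> A" "\<And>p. p \<in> X \<Longrightarrow> f p = \<beta> (g p)" by metis
    have "contains_pattern X L I A"
    proof (rule contains_patternI[of X g])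
      show "g p i < g q i" if "i \<in> I" "p \<in> X" "q \<in> X" "L i p < L i q" for i p q
        using f(2)[rule_format, OF that] g(2) that(2,3)
        by (intro block_less[where x = "g p" and y = "g q", OF _ that(1)]) simp
    qed (use g(1) in blast)
    with av show False by simp
  qed
  then have cB: "card (\<beta> ` A) \<le> b" using full \<beta>A by blast

  have cwide: "card (wide i) \<le> M * (2 ^ s * c)" if i: "i \<in> I" for i
  proof -
    have "\<forall>z\<in>wide i. \<exists>K. K \<subseteq> (\<lambda>x. x i) ` blk z \<and> card K = card X"
    proof
      fix z assume "z \<in> wide i"
      then have "card X \<le> card ((\<lambda>x. x i) ` blk z)" by (simp add: wide_def)
      then show "\<exists>K. K \<subseteq> (\<lambda>x. x i) ` blk z \<and> card K = card X"
        by (rule obtain_subset_with_card_n) blast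
    qed
    then obtain K where K: "\<And>z. z \<in> wide i \<Longrightarrow> K z \<subseteq> (\<lambda>x. x i) ` blk z"
        "\<And>z. z \<in> wide i \<Longrightarrow> card (K z) = card X"
      by metis
    have finw: "finite (wide i)" using finA by (simp add: wide_def)
    have "card {z \<in> wide i. z i = v} \<le> 2 ^ s * c" if v: "v \<in> {..<M}" for v
    proof -
      \<comment> \<open>The selected values of a block in slab \<open>v\<close> lie in an interval
        of length \<open>s\<close>; its subsets account for the factor \<open>2 ^ s\<close>.\<close>
      let ?T = "Pow {v * s..<v * s + s}"
      have "card {z \<in> wide i. z i = v} \<le> card ?T * c"
      proof (rule card_le_fibres[where g = K])
        show "finite {z \<in> wide i. z i = v}" "finite ?T" using finw by auto
        show "K ` {z \<in> wide i. z i = v} \<subseteq> ?T"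
        proof (intro image_subsetI PowI subsetI)
          fix z y assume z: "z \<in> {z \<in> wide i. z i = v}" and y: "y \<in> K z"
          obtain x where x: "x \<in> blk z" "y = x i"
            using K(1)[of z] z y by blast
          then have "\<beta> x i = v" using z by (simp add: blk_def)
          then have "x i div s = v" using i by (simp add: \<beta>_def)
          then show "y \<in> {v * s..<v * s + s}"
            using x(2) s dividend_less_times_div[of s "x i"] times_div_less_eq_dividend[of s "x i"]
            by (auto simp: mult.commute)
        qed
        fix T assume "T \<in> ?T"
        define F where "F = {z \<in> {z \<in> wide i. z i = v}. K z = T}"
        define R where "R z = restrict z (I - {i})" for z :: "'i \<Rightarrow> nat"
        have F: "z \<in> wide i" "z i = v" "K z = T" "z \<in> PiE I (\<lambda>_. {..<M})" if "z \<in> F" for z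
          using \<beta>A that by (auto simp: F_def wide_def)
        have inj: "inj_on R F"
        proof (rule inj_onI)
          fix z w assume z: "z \<in> F" and w: "w \<in> F" and eq: "R z = R w"
          have "z j = w j" if "j \<in> I" for j
          proof (cases "j = i")
            case True then show ?thesis using F(2)[OF z] F(2)[OF w] by simp
          next
            case False then show ?thesis using fun_cong[OF eq, of j] that by (simp add: R_def)
          qed
          then show "z = w" using F(4)[OF z] F(4)[OF w] by (metis PiE_ext)
        qed
        have sub: "R ` F \<subseteq> PiE (I - {i}) (\<lambda>_. {..<M})"
          using F(4) by (auto simp: R_def PiE_iff extensional_def split: if_splits)
        have "\<not> contains_pattern X L (I - {i}) (R ` F)"
        proof
          assume "contains_pattern X L (I - {i}) (R ` F)"
          then obtain f where f: "\<forall>p\<in>X. f p \<in> R ` F"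
              "\<forall>j\<in>I - {i}. \<forall>p\<in>X. \<forall>q\<in>X. L j p < L j q \<longrightarrow> f p j < f q j"
            by (rule contains_patternE)
          from image_choiceE[OF f(1)] obtain z
            where z: "\<And>p. p \<in> X \<Longrightarrow> z p \<in> F" "\<And>p. p \<in> X \<Longrightarrow> f p = R (z p)" by metis
          show False
          \<comment> \<open>Some \<open>p0\<close> is needed to know that \<open>T\<close> has
            \<open>card X\<close> elements; the empty pattern is contained in every set.\<close>
          proof (cases "X = {}")
            case True
            then show False using av by (simp add: contains_pattern_def)
          next
            case False
            then obtain p0 where p0: "p0 \<in> X" by blast
            then have "card T = card X" using F(1,3)[OF z(1)[OF p0]] K(2) by metis
            moreover have "finite T" using \<open>T \<in> ?T\<close> finite_subset by blast
            ultimately obtain g where g: "g ` X \<subseteq> T"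
                "\<And>p q. p \<in> X \<Longrightarrow> q \<in> X \<Longrightarrow> L i p < L i q \<Longrightarrow> g p < g q"
              using ex_order_copy[of T X "L i"] X(2)[OF i] by (metis order_refl)
            \<comment> \<open>Every block of \<open>F\<close> shows all values in \<open>T\<close>,
              so the value of coordinate \<open>i\<close> can be prescribed independently of the
              block.\<close>
            have "\<forall>p\<in>X. \<exists>x. x \<in> blk (z p) \<and> x i = g p"
            proof
              fix p assume p: "p \<in> X"
              have "g p \<in> K (z p)" using F(3)[OF z(1)[OF p]] g(1) p by auto
              then show "\<exists>x. x \<in> blk (z p) \<and> x i = g p" using K(1)[OF F(1)[OF z(1)[OF p]]] by force
            qed
            then obtain x where x: "\<And>p. p \<in> X \<Longrightarrow> x p \<in> blk (z p)" "\<And>p. p \<in> X \<Longrightarrow> x p i = g p"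
              by metis
            have "contains_pattern X L I A"
            proof (rule contains_patternI[of X x])
              show "x p \<in> A" if "p \<in> X" for p using x(1)[OF that] by (simp add: blk_def)
              fix j p q assume j: "j \<in> I" and pq: "p \<in> X" "q \<in> X" "L j p < L j q"
              show "x p j < x q j"
              proof (cases "j = i")
                case True
                then show ?thesis using g(2) x(2) pq by simp
              next
                case False
                then have "f p j < f q j" using f(2) pq j by simp
                then have "z p j < z q j" using z(2) pq False j by (simp add: R_def)
                then have "\<beta> (x p) j < \<beta> (x q) j" using x(1) pq by (simp add: blk_def)
                then show ?thesis using block_less[of "x p" j "x q"] j by simp
              qed
            qed
            with av show False by simp
          qed
        qed
        then have "card (R ` F) \<le> c" using face[OF i sub] by simp
        then show "card {z \<in> {z \<in> wide i. z i = v}. K z = T} \<le> c"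
          using card_image[OF inj] by (simp add: F_def)
      qed
      then show ?thesis by (simp add: card_Pow)
    qed
    moreover have "(\<lambda>z. z i) ` wide i \<subseteq> {..<M}"
      using \<beta>A i by (auto simp: wide_def)
    ultimately show ?thesis
      using card_le_fibres[OF finw, of "{..<M}" "\<lambda>z. z i" "2 ^ s * c"] by simp
  qed

  define W where "W = (\<Union>i\<in>I. wide i)"
  have "card W \<le> (\<Sum>i\<in>I. card (wide i))" unfolding W_def by (rule card_UN_le[OF I])
  also have "\<dots> \<le> card I * (M * (2 ^ s * c))"
    using sum_bounded_above[of I "\<lambda>i. card (wide i)"] cwide by simp
  finally have cW: "card W \<le> card I * (M * (2 ^ s * c))" .
  have W: "W \<subseteq> \<beta> ` A" by (auto simp: W_def wide_def)
  have blk_box: "card (blk z) \<le> (\<Prod>i\<in>I. card ((\<lambda>x. x i) ` blk z))" for z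
  proof -
    have "blk z \<subseteq> PiE I (\<lambda>i. (\<lambda>x. x i) ` blk z)"
      using A by (auto simp: blk_def PiE_iff subset_iff)
    then have "card (blk z) \<le> card (PiE I (\<lambda>i. (\<lambda>x. x i) ` blk z))"
      using I fblk by (intro card_mono finite_PiE) auto
    then show ?thesis by (simp add: card_PiE[OF I])
  qed
  have narrow: "card (blk z) \<le> card X ^ card I" if "z \<in> \<beta> ` A - W" for z
  proof -
    have "(\<Prod>i\<in>I. card ((\<lambda>x. x i) ` blk z)) \<le> (\<Prod>i\<in>I. card X)"
      using that by (intro prod_mono) (auto simp: W_def wide_def not_le)
    then show ?thesis using blk_box[of z] by simp
  qed
  have any: "card (blk z) \<le> s ^ card I" for z
  proof -
    have "card ((\<lambda>x. x i) ` blk z) \<le> s" if "i \<in> I" for i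
    proof -
      have "(\<lambda>x. x i) ` blk z \<subseteq> {z i * s..<z i * s + s}"
      proof
        fix y assume "y \<in> (\<lambda>x. x i) ` blk z"
        then obtain x where x: "x \<in> blk z" "y = x i" by blast
        then have "x i div s = z i" using that by (auto simp: blk_def \<beta>_def)
        then show "y \<in> {z i * s..<z i * s + s}"
          using x(2) s dividend_less_times_div[of s "x i"] times_div_less_eq_dividend[of s "x i"]
            by (auto simp: mult.commute)
      qed
      then show ?thesis using card_mono[of "{z i * s..<z i * s + s}"] by fastforce
    qed
    then have "(\<Prod>i\<in>I. card ((\<lambda>x. x i) ` blk z)) \<le> (\<Prod>i\<in>I. s)"
      by (intro prod_mono) auto
    then show ?thesis using blk_box[of z] by simp
  qed
  have "A = (\<Union>z\<in>\<beta> ` A. blk z)" by (auto simp: blk_def)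
  then have "card A \<le> (\<Sum>z\<in>\<beta> ` A. card (blk z))"
    using card_UN_le[of "\<beta> ` A" blk] finA by simp
  also have "\<dots> = (\<Sum>z\<in>\<beta> ` A - W. card (blk z)) + (\<Sum>z\<in>W. card (blk z))"
    using sum.subset_diff[OF W, of "\<lambda>z. card (blk z)"] finA by simp
  also have "\<dots> \<le> card (\<beta> ` A - W) * card X ^ card I + card W * s ^ card I"
    using sum_bounded_above[of "\<beta> ` A - W" "\<lambda>z. card (blk z)" "card X ^ card I"]
      sum_bounded_above[of W "\<lambda>z. card (blk z)" "s ^ card I"] narrow any
    by (intro add_mono) auto
  also have "\<dots> \<le> b * card X ^ card I + card I * (M * (2 ^ s * c)) * s ^ card I"
  proof -
    have "card (\<beta> ` A - W) \<le> card (\<beta> ` A)" using finA by (intro card_mono) auto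
    then show ?thesis using cB cW by (intro add_mono mult_right_mono) auto
  qed
  finally show ?thesis .
qed

text \<open>Outer induction on the dimension, inner induction on \<open>t\<close>, so that each
  contraction step passes from side \<open>s ^ Suc t\<close> to \<open>s ^ t\<close>. The recursion
  closes because enlarging the side by \<open>s\<close> multiplies the target by
  \<open>s ^ (card I - 1)\<close>, while narrow blocks contribute only a factor
  \<open>card X ^ card I\<close>. The square in \<open>s\<close> makes the former larger as soon as
  \<open>card I \<ge> 2\<close>.\<close>

lemma avoiding_power_cube:
  fixes L :: "'i \<Rightarrow> 'a \<Rightarrow> nat"
  assumes I: "finite I" "I \<noteq> {}"
    and X: "finite X" "\<And>i. i \<in> I \<Longrightarrow> bij_betw (L i) X {1..card X}"
    and s: "s = (card X + 1)\<^sup>2"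
  shows "\<exists>c. \<forall>t A. A \<subseteq> PiE I (\<lambda>_. {..<s ^ t}) \<longrightarrow> \<not> contains_pattern X L I A \<longrightarrow>
           card A \<le> c * (s ^ t) ^ (card I - 1)"
  using I X(2)
proof (induction "card I" arbitrary: I rule: less_induct)
  case less
  show ?case
  proof (cases "card I = 1")
    case True
    then obtain i where i: "I = {i}" using card_1_singletonE by blast
    show ?thesis
      using avoiding_power_cube_1[OF X(1), of L i] less.prems(3)[of i]
      by (intro exI[of _ "card X"]) (auto simp: i)
  next
    case False
    with less.prems(1,2) have c2: "card I \<ge> 2"
      by (metis One_nat_def Suc_leI card_gt_0_iff le_neq_implies_less numeral_2_eq_2)
    define d where "d = card I - 2"
    have d: "card I = d + 2" using c2 by (simp add: d_def)
    have "\<forall>i\<in>I. \<exists>c. \<forall>t A. A \<subseteq> PiE (I - {i}) (\<lambda>_. {..<s ^ t}) \<longrightarrow>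
        \<not> contains_pattern X L (I - {i}) A \<longrightarrow> card A \<le> c * (s ^ t) ^ d"
    proof
      fix i assume i: "i \<in> I"
      then have ci: "card (I - {i}) = d + 1" using d less.prems(1) by simp
      then have "I - {i} \<noteq> {}" by (metis card.empty add_is_0 one_neq_zero)
      then show "\<exists>c. \<forall>t A. A \<subseteq> PiE (I - {i}) (\<lambda>_. {..<s ^ t}) \<longrightarrow>
        \<not> contains_pattern X L (I - {i}) A \<longrightarrow> card A \<le> c * (s ^ t) ^ d"
        using less.hyps[of "I - {i}"] ci d less.prems by simp
    qed
    then obtain C where C: "\<And>i t A. i \<in> I \<Longrightarrow> A \<subseteq> PiE (I - {i}) (\<lambda>_. {..<s ^ t}) \<Longrightarrow>
        \<not> contains_pattern X L (I - {i}) A \<Longrightarrow> card A \<le> C i * (s ^ t) ^ d"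
      by metis
    define c where "c = (\<Sum>i\<in>I. C i)"
    have face: "card A \<le> c * (s ^ t) ^ d" if "i \<in> I" "A \<subseteq> PiE (I - {i}) (\<lambda>_. {..<s ^ t})"
        "\<not> contains_pattern X L (I - {i}) A" for i t A
    proof -
      have "C i \<le> c" unfolding c_def using that(1) less.prems(1) by (intro member_le_sum) auto
      then have "C i * (s ^ t) ^ d \<le> c * (s ^ t) ^ d" by (rule mult_right_mono) simp
      then show ?thesis using C[OF that] by linarith
    qed
    \<comment> \<open>The product is the coefficient of the wide-block term; the summand 1 covers
      the cube of side 1.\<close>
    define D where "D = card I * (2 ^ s * c) * s ^ card I + 1"
    \<comment> \<open>Uses \<open>d + 2 \<le> 2 * (d + 1)\<close>. The spare 1 on the left pays for
      the wide blocks.\<close>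
    have gap: "card X ^ card I + 1 \<le> s ^ (d + 1)"
    proof -
      have "card X ^ card I < (card X + 1) ^ card I" by (rule power_strict_mono) (use c2 in auto)
      also have "\<dots> \<le> (card X + 1) ^ (2 * (d + 1))" by (rule power_increasing) (use d in auto)
      also have "\<dots> = s ^ (d + 1)" by (simp only: s power_mult)
      finally show ?thesis by simp
    qed
    have "card A \<le> D * (s ^ t) ^ (d + 1)"
      if "A \<subseteq> PiE I (\<lambda>_. {..<s ^ t})" "\<not> contains_pattern X L I A" for t A
      using that
    proof (induction t arbitrary: A)
      case 0
      have "card A \<le> card (PiE I (\<lambda>_. {..<1::nat}))"
        using 0 less.prems(1) by (intro card_mono finite_PiE) auto
      then show ?case by (simp add: card_PiE less.prems(1) D_def)
    next
      case (Suc t)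
      have "card A \<le> D * (s ^ t) ^ (d + 1) * card X ^ card I +
          card I * (s ^ t * (2 ^ s * (c * (s ^ t) ^ d))) * s ^ card I"
      proof (rule avoiding_power_cube_step[OF less.prems(1) X(1) less.prems(3)])
        show "s > 0" using s by simp
        show "A \<subseteq> PiE I (\<lambda>_. {..<s ^ t * s})" using Suc.prems(1) by (simp add: mult.commute)
      qed (use Suc face in auto)
      also have "\<dots> \<le> D * (s ^ t) ^ (d + 1) * card X ^ card I + D * (s ^ t) ^ (d + 1)"
        by (simp add: D_def algebra_simps)
      also have "\<dots> = D * (s ^ t) ^ (d + 1) * (card X ^ card I + 1)" by (simp add: algebra_simps)
      also have "\<dots> \<le> D * (s ^ t) ^ (d + 1) * s ^ (d + 1)" using gap by (rule mult_left_mono) simp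
      also have "\<dots> = D * (s ^ Suc t) ^ (d + 1)"
        by (simp only: power_Suc2 power_mult_distrib mult.assoc)
      finally show ?case .
    qed
    then show ?thesis unfolding d by (intro exI[of _ D]) simp
  qed
qed

text \<open>Tile the box by cubes whose side \<open>m\<close> is the least power of \<open>s\<close>
  that is at least the shortest side \<open>l j\<close>. Direction \<open>j\<close> then needs one
  layer of tiles, and minimality gives \<open>m \<le> s * l j \<le> s * l i\<close>, so rounding up
  the number of tiles in another direction costs at most a factor \<open>s + 1\<close>.\<close>

lemma avoiding_box:
  fixes L :: "'i \<Rightarrow> 'a \<Rightarrow> nat"
  assumes I: "finite I" "I \<noteq> {}"
    and X: "finite X" "\<And>i. i \<in> I \<Longrightarrow> bij_betw (L i) X {1..card X}"
  shows "\<exists>c. \<forall>l A. A \<subseteq> PiE I (\<lambda>i. {..<l i}) \<longrightarrow> \<not> contains_pattern X L I A \<longrightarrow>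
           card A \<le> c * (\<Sum>j\<in>I. \<Prod>i\<in>I - {j}. l i)"
\<comment> \<open>With \<open>X\<close> empty, \<open>s\<close> would be 1 and its powers would not
  grow; the claim is then vacuous.\<close>
proof (cases "X = {}")
  case True
  then show ?thesis by (auto simp: contains_pattern_def)
next
  case False
  define s where "s = (card X + 1)\<^sup>2"
  have s: "s > 1" using False X(1) unfolding s_def by (intro one_less_power) (simp_all add: card_gt_0_iff)
  obtain c where c: "\<And>t A. A \<subseteq> PiE I (\<lambda>_. {..<s ^ t}) \<Longrightarrow> \<not> contains_pattern X L I A \<Longrightarrow>
      card A \<le> c * (s ^ t) ^ (card I - 1)"
    using avoiding_power_cube[of I X L s, OF I X s_def] by blast
  have "card A \<le> (c * (s + 1) ^ (card I - 1)) * (\<Sum>j\<in>I. \<Prod>i\<in>I - {j}. l i)"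
    if A: "A \<subseteq> PiE I (\<lambda>i. {..<l i})" and av: "\<not> contains_pattern X L I A"
    for l :: "'i \<Rightarrow> nat" and A
  proof (cases "A = {}")
    case False
    then have lpos: "l i > 0" if "i \<in> I" for i
      using A that by (fastforce simp: PiE_iff)
    obtain j where j: "j \<in> I" "\<And>i. i \<in> I \<Longrightarrow> l j \<le> l i"
      using arg_min_if_finite[of I l] I by (metis leI)
    define t where "t = (LEAST t. l j \<le> s ^ t)"
    have ex: "\<exists>t. l j \<le> s ^ t"
      using s power_gt_expt[of s "l j"] by (intro exI[of _ "l j"]) simp
    then have t1: "l j \<le> s ^ t" unfolding t_def by (rule LeastI_ex)
    have t2: "s ^ t \<le> s * l j"
    proof (cases t)
      case 0 then show ?thesis using lpos[OF j(1)] s by simp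
    next
      case (Suc u)
      then have "\<not> l j \<le> s ^ u" using not_less_Least[of u "\<lambda>t. l j \<le> s ^ t"] by (simp add: t_def)
      then show ?thesis using Suc by simp
    qed
    define m where "m = s ^ t"
    have m: "m > 0" using s by (simp add: m_def)
    define \<beta> where "\<beta> x = (\<lambda>i\<in>I. x i div m)" for x :: "'i \<Rightarrow> nat"
    define T where "T = PiE I (\<lambda>i. if i = j then {0} else {..<l i div m + 1})"
    have fin: "finite A" by (rule finite_subset[OF A]) (intro finite_PiE I, auto)
    have xl: "x i < l i" if "x \<in> A" "i \<in> I" for x i using A that by (auto simp: PiE_iff subset_iff)
    have "card A \<le> card T * (c * m ^ (card I - 1))"
    proof (rule card_le_fibres[where g = \<beta>])
      show "finite A" by fact
      show "finite T" unfolding T_def by (intro finite_PiE I) auto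
      show "\<beta> ` A \<subseteq> T"
      proof
        fix z assume "z \<in> \<beta> ` A"
        then obtain x where x: "x \<in> A" "z = \<beta> x" by blast
        have "x j div m = 0" using xl[OF x(1) j(1)] t1 by (simp add: m_def)
        moreover have "x i div m < l i div m + 1" if "i \<in> I" for i
          using div_le_mono[of "x i" "l i" m] xl[OF x(1) that] by simp
        ultimately show "z \<in> T" by (auto simp: T_def x \<beta>_def)
      qed
      fix z assume "z \<in> T"
      let ?F = "{x \<in> A. \<beta> x = z}"
      let ?r = "\<lambda>x. \<lambda>i\<in>I. x i mod m"
      have dec: "x i = z i * m + x i mod m" if "x \<in> ?F" "i \<in> I" for x i
      proof -
        have "z i = x i div m" using that by (auto simp: \<beta>_def)
        then show ?thesis by simp
      qed
      have inj: "inj_on ?r ?F"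
      proof (rule inj_onI)
        fix x y assume x: "x \<in> ?F" and y: "y \<in> ?F" and eq: "?r x = ?r y"
        have "x i = y i" if "i \<in> I" for i
          using dec[OF x that] dec[OF y that] fun_cong[OF eq, of i] that by simp
        moreover have "x \<in> PiE I (\<lambda>i. {..<l i})" "y \<in> PiE I (\<lambda>i. {..<l i})" using A x y by blast+
        ultimately show "x = y" by (metis PiE_ext)
      qed
      have "\<not> contains_pattern X L I (?r ` ?F)"
      proof
        assume "contains_pattern X L I (?r ` ?F)"
        then obtain f where f: "\<forall>p\<in>X. f p \<in> ?r ` ?F"
        "\<forall>i\<in>I. \<forall>p\<in>X. \<forall>q\<in>X. L i p < L i q \<longrightarrow> f p i < f q i"
      by (rule contains_patternE)
        from image_choiceE[OF f(1)] obtain g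
          where g: "\<And>p. p \<in> X \<Longrightarrow> g p \<in> ?F" "\<And>p. p \<in> X \<Longrightarrow> f p = ?r (g p)" by metis
        have "contains_pattern X L I A"
        proof (rule contains_patternI[of X g])
          show "g p \<in> A" if "p \<in> X" for p using g(1)[OF that] by simp
          fix i p q assume i: "i \<in> I" and pq: "p \<in> X" "q \<in> X" "L i p < L i q"
          then have "g p i mod m < g q i mod m" using f(2)[rule_format, OF i pq] pq(1,2) g(2) by (simp add: i)
          then show "g p i < g q i" using dec[OF g(1)[OF pq(1)] i] dec[OF g(1)[OF pq(2)] i] by linarith
        qed
        with av show False by simp
      qed
      moreover have "?r ` ?F \<subseteq> PiE I (\<lambda>_. {..<s ^ t})" using m by (auto simp: m_def)
      ultimately have "card (?r ` ?F) \<le> c * m ^ (card I - 1)" unfolding m_def using c by blast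
      then show "card ?F \<le> c * m ^ (card I - 1)" using card_image[OF inj] by simp
    qed
    also have "card T = (\<Prod>i\<in>I - {j}. l i div m + 1)"
    proof -
      have "card T = (\<Prod>i\<in>I. card (if i = j then {0} else {..<l i div m + 1}))"
        unfolding T_def by (rule card_PiE[OF I(1)])
      also have "\<dots> = (\<Prod>i\<in>I - {j}. card (if i = j then {0} else {..<l i div m + 1}))"
        using prod.remove[OF I(1) j(1), of "\<lambda>i. card (if i = j then {0} else {..<l i div m + 1})"] by simp
      also have "\<dots> = (\<Prod>i\<in>I - {j}. l i div m + 1)" by (rule prod.cong) auto
      finally show ?thesis .
    qed
    also have "(\<Prod>i\<in>I - {j}. l i div m + 1) * (c * m ^ (card I - 1)) =
        c * (\<Prod>i\<in>I - {j}. (l i div m + 1) * m)"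
      using j I by (simp only: prod.distrib prod_constant card_Diff_singleton mult_ac)
    also have "\<dots> \<le> c * (\<Prod>i\<in>I - {j}. (s + 1) * l i)"
    proof (intro mult_left_mono prod_mono)
      fix i assume "i \<in> I - {j}"
      then have "m \<le> s * l i" using t2 mult_le_mono2[OF j(2), of i s] unfolding m_def by (meson DiffD1 le_trans)
      moreover have "m * (l i div m) \<le> l i" by simp
      ultimately have "(l i div m + 1) * m \<le> (s + 1) * l i"
        by (simp only: distrib_right mult_1 mult.commute[of "l i div m"])
      then show "0 \<le> (l i div m + 1) * m \<and> (l i div m + 1) * m \<le> (s + 1) * l i" by simp
    qed simp
    also have "\<dots> = (c * (s + 1) ^ (card I - 1)) * (\<Prod>i\<in>I - {j}. l i)"
      using j I by (simp only: prod.distrib prod_constant card_Diff_singleton mult_ac)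
    \<comment> \<open>The shortest direction varies from box to box. The sum over all facets does
      not depend on it and can be added up over a family of boxes.\<close>
    also have "\<dots> \<le> (c * (s + 1) ^ (card I - 1)) * (\<Sum>j\<in>I. \<Prod>i\<in>I - {j}. l i)"
      using member_le_sum[of j I "\<lambda>j. \<Prod>i\<in>I - {j}. l i"] j I by (intro mult_left_mono) auto
    finally show ?thesis .
  qed simp
  then show ?thesis by blast
qed

section \<open>The grid\<close>

lemma finite_grid: "finite (grid k n)"
  using finite_lists_length_eq[of "{1..k}" n] by (simp add: grid_def conj_commute)

lemma grid_0: "grid k 0 = {[]}"
  by (auto simp: grid_def)

lemma Cons_in_grid_iff: "v # x \<in> grid k (Suc n) \<longleftrightarrow> 1 \<le> v \<and> v \<le> k \<and> x \<in> grid k n"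
  by (auto simp: grid_def)

lemma grid_Suc: "grid k (Suc n) = (\<lambda>(v, x). v # x) ` ({1..k} \<times> grid k n)"
proof (intro equalityI subsetI)
  fix x assume "x \<in> grid k (Suc n)"
  then show "x \<in> (\<lambda>(v, x). v # x) ` ({1..k} \<times> grid k n)"
    by (cases x) (auto simp: grid_def)
qed (auto simp: grid_def)

lemma sum_grid_Suc: "(\<Sum>x\<in>grid k (Suc n). f x) = (\<Sum>v=1..k. \<Sum>x\<in>grid k n. f (v # x))"
proof -
  have "(\<Sum>x\<in>grid k (Suc n). f x) = (\<Sum>(v, x)\<in>{1..k} \<times> grid k n. f (v # x))"
    unfolding grid_Suc by (subst sum.reindex) (auto simp: inj_on_def split_def intro: sum.cong)
  then show ?thesis by (simp add: sum.cartesian_product)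
qed

lemma card_grid: "card (grid k n) = k ^ n"
proof (induction n)
  case (Suc n)
  have "inj_on (\<lambda>(v, x). v # x) ({1..k} \<times> grid k n)" by (auto simp: inj_on_def)
  then show ?case using Suc by (simp add: grid_Suc card_image card_cartesian_product)
qed (simp add: grid_0)

lemma grid_le_Cons [simp]: "grid_le (v # x) (w # y) \<longleftrightarrow> v \<le> w \<and> grid_le x y"
  by (simp add: grid_le_def)

lemma grid_le_refl [simp]: "grid_le x x"
  by (simp add: grid_le_def list_all2_refl)

lemma grid_le_sum_list: "grid_le x y \<Longrightarrow> sum_list x \<le> sum_list y"
  unfolding grid_le_def by (induction rule: list_all2_induct) auto

lemma grid_le_sum_list_eq: "grid_le x y \<Longrightarrow> sum_list y \<le> sum_list x \<Longrightarrow> x = y"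
  unfolding grid_le_def
proof (induction rule: list_all2_induct)
  case (Cons a x b y)
  moreover have "sum_list x \<le> sum_list y" using Cons(2) grid_le_sum_list by (simp add: grid_le_def)
  ultimately show ?case by simp
qed simp

lemma antichain_layer: "antichain_in (grid k n) grid_le {x \<in> grid k n. sum_list x = s}"
  unfolding antichain_in_def using grid_le_sum_list_eq by fastforce

section \<open>Symmetric chains\<close>

text \<open>The least element of the symmetric chain containing \<open>x\<close> in the decomposition of de Bruijn,
  Tengbergen and Kruyswijk: a symmetric chain with bottom \<open>b\<close> times \<open>{1..k}\<close> is cut into
  hooks, the \<open>j\<close>-th of which runs up the chain at height \<open>j\<close>, turns \<open>j - 1\<close> steps below its top, and
  then increases the new coordinate. A symmetric chain with bottom \<open>b\<close> ends at the level
  \<open>length b * (k + 1) - sum_list b\<close>.\<close>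

fun chain_bottom :: "nat \<Rightarrow> nat list \<Rightarrow> nat list" where
  "chain_bottom k [] = []"
| "chain_bottom k (v # x) =
     min v (length x * (k + 1) - sum_list (chain_bottom k x) - sum_list x + 1) # chain_bottom k x"

text \<open>Places \<open>x\<close> between the bottom level of its chain and the symmetric top
  level. It also ensures that the natural-number subtractions in \<open>chain_bottom\<close> do not
  truncate.\<close>

lemma chain_bottom_bounds:
  "x \<in> grid k n \<Longrightarrow> sum_list (chain_bottom k x) \<le> sum_list x \<and>
     sum_list x + sum_list (chain_bottom k x) \<le> n * (k + 1)"
proof (induction n arbitrary: x)
  case 0
  then show ?case by (simp add: grid_0)
next
  case (Suc n)
  then obtain v y where x: "x = v # y" "1 \<le> v" "v \<le> k" "y \<in> grid k n"
    by (auto simp: grid_Suc)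
  moreover have "length y = n" using x by (simp add: grid_def)
  ultimately show ?case using Suc.IH[OF x(4)] by (auto simp: min_def)
qed

lemma chain_bottom_comparable:
  assumes "x \<in> grid k n" "y \<in> grid k n" "chain_bottom k x = chain_bottom k y"
  shows "grid_le x y \<or> grid_le y x"
  using assms
proof (induction n arbitrary: x y)
  case 0
  then show ?case by (simp add: grid_0)
next
  case (Suc n)
  obtain v x' where x: "x = v # x'" "x' \<in> grid k n"
    using Suc.prems by (auto simp: grid_Suc)
  obtain w y' where y: "y = w # y'" "y' \<in> grid k n"
    using Suc.prems by (auto simp: grid_Suc)
  have len: "length x' = n" "length y' = n" using x y by (auto simp: grid_def)
  define T where "T = n * (k + 1) - sum_list (chain_bottom k x')"
  have eq: "chain_bottom k x' = chain_bottom k y'"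
    using Suc.prems(3) x y by simp
  have m: "min v (T - sum_list x' + 1) = min w (T - sum_list y' + 1)"
    using Suc.prems(3) x y eq len by (simp add: T_def)
  have b: "sum_list x' \<le> T" "sum_list y' \<le> T"
    using chain_bottom_bounds[OF x(2)] chain_bottom_bounds[OF y(2)] eq by (auto simp: T_def)
  \<comment> \<open>If \<open>v > w\<close>, the common minimum is below \<open>v\<close>, hence
    equals \<open>T - sum_list x' + 1\<close>. Comparing it with the other minimum shows that
    \<open>y'\<close> is on no higher level than \<open>x'\<close>, so the two coincide.\<close>
  have *: "grid_le (v # x') (w # y') \<or> grid_le (w # y') (v # x')"
    if "grid_le x' y'" "min v (T - sum_list x' + 1) = min w (T - sum_list y' + 1)"
      "sum_list y' \<le> T" for v w x' y'
  proof (cases "v \<le> w")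
    case False
    with that have "sum_list y' \<le> sum_list x'" by linarith
    then have "x' = y'" using grid_le_sum_list_eq that(1) by blast
    then show ?thesis using False by simp
  qed (use that in simp)
  have "grid_le x' y' \<or> grid_le y' x'" using Suc.IH x y eq by blast
  then show ?case using *[of x' y' v w] *[of y' x' w v] m b x y by metis
qed

text \<open>Walks along the hook of index \<open>j\<close>: up the old chain with new coordinate
  \<open>j\<close>, then up the new coordinate at the turning point. Both legs together meet every
  level between bottom and symmetric top.\<close>

lemma chain_bottom_surj_level:
  assumes "x \<in> grid k n" "sum_list (chain_bottom k x) \<le> s"
    "s + sum_list (chain_bottom k x) \<le> n * (k + 1)"
  shows "\<exists>y\<in>grid k n. chain_bottom k y = chain_bottom k x \<and> sum_list y = s"
  using assms
proof (induction n arbitrary: x s)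
  case 0
  then show ?case by (simp add: grid_0)
next
  case (Suc n)
  obtain v x' where x: "x = v # x'" "1 \<le> v" "v \<le> k" "x' \<in> grid k n"
    using Suc.prems(1) by (auto simp: grid_Suc)
  have len: "length y = n" if "y \<in> grid k n" for y using that by (auto simp: grid_def)
  define b where "b = sum_list (chain_bottom k x')"
  define T where "T = n * (k + 1) - b"
  define j where "j = min v (T - sum_list x' + 1)"
  have cb: "chain_bottom k x = j # chain_bottom k x'"
    using x len by (simp add: j_def T_def b_def)
  have bnd: "b \<le> sum_list x'" "sum_list x' + b \<le> n * (k + 1)"
    using chain_bottom_bounds[OF x(4)] by (auto simp: b_def)
  have j: "1 \<le> j" "j \<le> k" "j - 1 + b \<le> T" "T + b = n * (k + 1)"
    using x bnd by (auto simp: j_def T_def)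
  have s: "j + b \<le> s" "s + j \<le> T + (k + 1)"
    using Suc.prems(2,3) cb j(4) by (auto simp: b_def)
  show ?case
  \<comment> \<open>The turn is at old level \<open>T - (j - 1)\<close> with new coordinate
    \<open>j\<close>, hence at total level \<open>T + 1\<close>.\<close>
  proof (cases "s \<le> T + 1")
    case True
    then have "b \<le> s - j" "s - j + b \<le> n * (k + 1)" using s j by auto
    then obtain y where y: "y \<in> grid k n" "chain_bottom k y = chain_bottom k x'" "sum_list y = s - j"
      using Suc.IH[OF x(4), of "s - j"] by (auto simp: b_def)
    have "chain_bottom k (j # y) = chain_bottom k x"
      using y len True j s cb by (simp add: T_def b_def)
    then show ?thesis
      using y j s by (intro bexI[of _ "j # y"]) (auto simp: Cons_in_grid_iff)
  next
    case False
    define r where "r = T - (j - 1)"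
    have "b \<le> r" "r + b \<le> n * (k + 1)" using j by (auto simp: r_def)
    then obtain y where y: "y \<in> grid k n" "chain_bottom k y = chain_bottom k x'" "sum_list y = r"
      using Suc.IH[OF x(4), of r] by (auto simp: b_def)
    define w where "w = s - r"
    have w: "j \<le> w" "w \<le> k" "w + r = s" using False s j by (auto simp: w_def r_def)
    have "T - r + 1 = j" using j by (simp add: r_def)
    then have "chain_bottom k (w # y) = chain_bottom k x"
      using y len w cb by (simp add: T_def b_def)
    then show ?thesis
      using y j w by (intro bexI[of _ "w # y"]) (auto simp: Cons_in_grid_iff)
  qed
qed

text \<open>Twice the bottom level is at most \<open>n * (k + 1)\<close>, by adding the two bounds,
  so by symmetry every chain crosses the middle level, also after rounding down.\<close>

lemma card_chain_bottoms_le_middle: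
  "card (chain_bottom k ` grid k n) \<le> card {x \<in> grid k n. sum_list x = n * (k + 1) div 2}"
proof -
  let ?s = "n * (k + 1) div 2"
  have "chain_bottom k ` grid k n \<subseteq> chain_bottom k ` {x \<in> grid k n. sum_list x = ?s}"
  proof (rule image_subsetI)
    fix x assume x: "x \<in> grid k n"
    have "\<exists>y\<in>grid k n. chain_bottom k y = chain_bottom k x \<and> sum_list y = ?s"
      using chain_bottom_bounds[OF x] by (intro chain_bottom_surj_level[OF x]) linarith+
    then show "chain_bottom k x \<in> chain_bottom k ` {x \<in> grid k n. sum_list x = ?s}"
      by (metis (mono_tags, lifting) image_eqI mem_Collect_eq)
  qed
  then have "card (chain_bottom k ` grid k n) \<le> card (chain_bottom k ` {x \<in> grid k n. sum_list x = ?s})"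
    by (intro card_mono finite_imageI) (simp_all add: finite_grid)
  also have "\<dots> \<le> card {x \<in> grid k n. sum_list x = ?s}"
    by (rule card_image_le) (simp add: finite_grid)
  finally show ?thesis .
qed

text \<open>An antichain meets each chain at most once, so \<open>chain_bottom\<close> is injective
  on it. The case \<open>k = 2\<close> is the Sperner theorem.\<close>

lemma antichain_le_middle:
  assumes "A \<subseteq> grid k n" "\<And>x y. x \<in> A \<Longrightarrow> y \<in> A \<Longrightarrow> grid_le x y \<Longrightarrow> x = y"
  shows "card A \<le> card {x \<in> grid k n. sum_list x = n * (k + 1) div 2}"
proof -
  have "inj_on (chain_bottom k) A"
  proof (rule inj_onI)
    fix x y assume "x \<in> A" "y \<in> A" "chain_bottom k x = chain_bottom k y"
    then show "x = y" using chain_bottom_comparable[of x k n y] assms by blast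
  qed
  then have "card A = card (chain_bottom k ` A)" by (simp add: card_image)
  also have "\<dots> \<le> card (chain_bottom k ` grid k n)"
    using assms(1) by (intro card_mono finite_imageI finite_grid) auto
  also have "\<dots> \<le> card {x \<in> grid k n. sum_list x = n * (k + 1) div 2}"
    by (rule card_chain_bottoms_le_middle)
  finally show ?thesis .
qed

section \<open>Concentration of the level sums\<close>

lemma card_Cons_filter:
  "card {x \<in> grid k (Suc n). P x} = (\<Sum>v=1..k. card {x \<in> grid k n. P (v # x)})"
proof -
  have c: "card {x \<in> grid k m. Q x} = (\<Sum>x\<in>grid k m. if Q x then 1 else 0)" for m Q
    by (simp add: sum.If_cases finite_grid Int_def)
  show ?thesis unfolding c sum_grid_Suc ..
qed

text \<open>\<open>grid 2 n\<close> is the Boolean lattice with 1 for absent and 2 for present; the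
  induction is the Pascal rule.\<close>

lemma card_layer_grid_2: "card {x \<in> grid 2 n. sum_list x = n + r} = n choose r"
proof (induction n arbitrary: r)
  case 0
  have "{x \<in> {[]}. sum_list x = 0 + r} = (if r = 0 then {[]} else {})" by auto
  then show ?case by (cases r) (simp_all add: grid_0)
next
  case (Suc n)
  note IH = Suc.IH
  have two: "{1..2::nat} = {1, 2}" by auto
  have "card {x \<in> grid 2 (Suc n). sum_list x = Suc n + r} =
      card {x \<in> grid 2 n. 1 + sum_list x = Suc n + r} + card {x \<in> grid 2 n. 2 + sum_list x = Suc n + r}"
    unfolding card_Cons_filter two by simp
  also have "{x \<in> grid 2 n. 1 + sum_list x = Suc n + r} = {x \<in> grid 2 n. sum_list x = n + r}"
    by auto
  also have "card {x \<in> grid 2 n. 2 + sum_list x = Suc n + r} = (if r = 0 then 0 else n choose (r - 1))"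
  proof (cases r)
    case 0
    have "n \<le> sum_list x" if "x \<in> grid 2 n" for x
    proof -
      have "length x \<le> sum_list x" if "\<forall>v\<in>set x. 1 \<le> v" for x :: "nat list"
        using that by (induction x) auto
      moreover have "\<forall>v\<in>set x. 1 \<le> v" "length x = n" using that by (auto simp: grid_def)
      ultimately show ?thesis by blast
    qed
    then have e: "{x \<in> grid 2 n. 2 + sum_list x = Suc n + r} = {}" using 0 by force
    show ?thesis unfolding e using 0 by simp
  next
    case (Suc r')
    then have "{x \<in> grid 2 n. 2 + sum_list x = Suc n + r} = {x \<in> grid 2 n. sum_list x = n + r'}"
      by auto
    then show ?thesis using Suc IH[of r'] by simp
  qed
  finally show ?case using IH[of r] by (cases r) auto
qed

text \<open>Squaring and carrying the factor \<open>2 * n + 1\<close> makes the induction close over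
  the naturals: the ratio of consecutive coefficients reduces it to
  \<open>(2 * n + 1) * (2 * n + 3) \<le> 4 * (n + 1)^2\<close>.\<close>

lemma central_binomial_upper:
  "((2 * n) choose n)\<^sup>2 * (2 * n + 1) \<le> (16::nat) ^ n"
proof (induction n)
  case (Suc n)
  let ?c = "(2 * n) choose n"
  have rec: "(n + 1) * ((2 * Suc n) choose Suc n) = 2 * (2 * n + 1) * ?c"
  proof -
    have "(n + 1) * ((2 * Suc n) choose Suc n) = 2 * (n + 1) * ((2 * n + 1) choose n)"
      using Suc_times_binomial_eq[of "2 * n + 1" n] by (simp add: mult.commute)
    also have "(2 * n + 1) choose n = (2 * n + 1) choose Suc n"
      using binomial_symmetric[of n "2 * n + 1"] by simp
    also have "2 * (n + 1) * ((2 * n + 1) choose Suc n) = 2 * (2 * n + 1) * ?c"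
      using Suc_times_binomial_eq[of "2 * n" n] by (simp add: mult.commute)
    finally show ?thesis .
  qed
  define a b where "a = (2 * Suc n) choose Suc n" and "b = ?c"
  have rec: "(n + 1) * a = 2 * (2 * n + 1) * b" and IH: "b\<^sup>2 * (2 * n + 1) \<le> 16 ^ n"
    using rec Suc.IH by (simp_all only: a_def b_def)
  have "(n + 1)\<^sup>2 * (a\<^sup>2 * (2 * n + 3)) = ((n + 1) * a)\<^sup>2 * (2 * n + 3)"
    by (simp only: power_mult_distrib mult.assoc)
  also have "\<dots> = (b\<^sup>2 * (2 * n + 1)) * (4 * (2 * n + 1) * (2 * n + 3))"
    unfolding rec by (simp add: power2_eq_square algebra_simps)
  also have "\<dots> \<le> 16 ^ n * (16 * (n + 1)\<^sup>2)"
    using IH by (rule mult_mono) (simp_all add: power2_eq_square algebra_simps)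
  also have "\<dots> = (n + 1)\<^sup>2 * 16 ^ Suc n" by (simp add: algebra_simps)
  finally have "a\<^sup>2 * (2 * n + 3) \<le> 16 ^ Suc n" by (simp only: mult_le_cancel1) simp
  moreover have "2 * Suc n + 1 = 2 * n + 3" by simp
  ultimately show ?case by (simp only: a_def)
qed simp

text \<open>For odd \<open>m\<close> the central coefficient of the next even number is exactly
  twice the middle one of \<open>m\<close>.\<close>

lemma middle_binomial_upper: "(m choose (m div 2))\<^sup>2 * (m + 1) \<le> (4::nat) ^ m"
proof (cases "even m")
  case True
  then obtain n where m: "m = 2 * n" by blast
  have "(16::nat) ^ n = 4 ^ m" by (simp add: m power_mult)
  then show ?thesis using central_binomial_upper[of n] by (simp add: m)
next
  case False
  then obtain n where m: "m = 2 * n + 1" using oddE by blast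
  have "(2 * Suc n) choose Suc n = 2 * (m choose (m div 2))"
    using binomial_symmetric[of "Suc n" "2 * n + 1"] by (simp add: m)
  moreover have "2 * Suc n + 1 = m + 2" by (simp add: m)
  ultimately have "(2 * (m choose (m div 2)))\<^sup>2 * (m + 2) \<le> 16 ^ Suc n"
    using central_binomial_upper[of "Suc n"] by (simp only:)
  also have "(16::nat) ^ Suc n = 4 * 4 ^ m" by (simp add: m power_mult)
  finally have "4 * ((m choose (m div 2))\<^sup>2 * (m + 2)) \<le> 4 * 4 ^ m"
    by (simp only: power_mult_distrib mult.assoc) simp
  then show ?thesis by simp
qed

section \<open>Coupling of the grid with the Boolean lattice\<close>

definition shift_mod :: "nat \<Rightarrow> nat \<Rightarrow> nat" where
  "shift_mod k v = (if v + k div 2 \<le> k then v + k div 2 else v + k div 2 - k)"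

text \<open>Chooses the smaller or larger element of the pair formed by \<open>v\<close> and its
  cyclic shift by \<open>k div 2\<close>. A cyclic shift is a permutation for every
  \<open>k\<close>, whereas a perfect matching of the values would require \<open>k\<close> even.
  The choices 1 and 2 let \<open>grid 2 n\<close> serve as the Boolean lattice.\<close>

definition pick :: "nat \<Rightarrow> nat \<Rightarrow> nat \<Rightarrow> nat" where
  "pick k v e = (if e = 1 then min v (shift_mod k v) else max v (shift_mod k v))"

lemma bij_betw_shift_mod: "bij_betw (shift_mod k) {1..k} {1..k}"
proof (rule bij_betw_byWitness[where f' = "\<lambda>w. if k div 2 < w then w - k div 2 else w + k - k div 2"])
  have h: "k div 2 \<le> k" by simp
  show "\<forall>v\<in>{1..k}. (if k div 2 < shift_mod k v then shift_mod k v - k div 2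
          else shift_mod k v + k - k div 2) = v"
    using h by (auto simp: shift_mod_def)
  show "\<forall>w\<in>{1..k}. shift_mod k (if k div 2 < w then w - k div 2 else w + k - k div 2) = w"
    using h by (auto simp: shift_mod_def)
  show "shift_mod k ` {1..k} \<subseteq> {1..k}"
    using h by (auto simp: shift_mod_def)
  show "(\<lambda>w. if k div 2 < w then w - k div 2 else w + k - k div 2) ` {1..k} \<subseteq> {1..k}"
    using h by auto
qed

text \<open>Without wrap-around the two values differ by \<open>k div 2\<close>, with it by
  \<open>k - k div 2\<close>, which is no smaller.\<close>

lemma pick_gap: "pick k v 1 + k div 2 \<le> pick k v 2"
proof -
  have "k div 2 + k div 2 \<le> k" by linarith
  then show ?thesis by (auto simp: pick_def shift_mod_def)
qed

lemma sum_pick: "(\<Sum>v=1..k. g (pick k v 1) + g (pick k v 2)) = 2 * (\<Sum>v=1..k. (g v :: nat))"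
proof -
  have "g (pick k v 1) + g (pick k v 2) = g v + g (shift_mod k v)" for v
    by (auto simp: pick_def min_def max_def)
  then have "(\<Sum>v=1..k. g (pick k v 1) + g (pick k v 2)) =
      (\<Sum>v=1..k. g v) + (\<Sum>v=1..k. g (shift_mod k v))"
    by (simp add: sum.distrib)
  also have "(\<Sum>v=1..k. g (shift_mod k v)) = (\<Sum>v=1..k. g v)"
    by (rule sum.reindex_bij_betw[OF bij_betw_shift_mod])
  finally show ?thesis by simp
qed

text \<open>Counting form of the statement that the coupling preserves the uniform distribution:
  each grid point arises from exactly \<open>2 ^ n\<close> pairs \<open>(p, e)\<close>.\<close>

lemma sum_map2_pick:
  "(\<Sum>p\<in>grid k n. \<Sum>e\<in>grid 2 n. f (map2 (pick k) p e)) = 2 ^ n * (\<Sum>x\<in>grid k n. (f x :: nat))"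
proof (induction n arbitrary: f)
  case 0
  then show ?case by (simp add: grid_0)
next
  case (Suc n)
  have two: "{1..2::nat} = {1, 2}" by auto
  define g where "g v = (\<Sum>x\<in>grid k n. f (v # x))" for v
  have IH: "(\<Sum>p\<in>grid k n. \<Sum>e\<in>grid 2 n. f (w # map2 (pick k) p e)) = 2 ^ n * g w" for w
    using Suc.IH[of "\<lambda>x. f (w # x)"] by (simp add: g_def)
  have "(\<Sum>p\<in>grid k (Suc n). \<Sum>e\<in>grid 2 (Suc n). f (map2 (pick k) p e)) =
      (\<Sum>v=1..k. \<Sum>p\<in>grid k n. (\<Sum>e\<in>grid 2 n. f (pick k v 1 # map2 (pick k) p e)) +
                            (\<Sum>e\<in>grid 2 n. f (pick k v 2 # map2 (pick k) p e)))"
    unfolding sum_grid_Suc two by simp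
  also have "\<dots> = (\<Sum>v=1..k. 2 ^ n * g (pick k v 1) + 2 ^ n * g (pick k v 2))"
    by (simp only: sum.distrib IH)
  also have "\<dots> = 2 ^ n * (2 * (\<Sum>v=1..k. g v))"
    using sum_pick[of "\<lambda>v. 2 ^ n * g v" k] by (simp add: sum_distrib_left mult.left_commute)
  finally show ?case by (simp add: sum_grid_Suc g_def)
qed

lemma map2_pick_gap:
  assumes "p \<in> grid k n" "e \<in> grid 2 n" "e' \<in> grid 2 n" "grid_le e e'"
  shows "sum_list (map2 (pick k) p e) \<le> sum_list (map2 (pick k) p e')"
    and "e \<noteq> e' \<Longrightarrow> sum_list (map2 (pick k) p e) + k div 2 \<le> sum_list (map2 (pick k) p e')"
proof -
  have "sum_list (map2 (pick k) p e) \<le> sum_list (map2 (pick k) p e') \<and>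
    (e \<noteq> e' \<longrightarrow> sum_list (map2 (pick k) p e) + k div 2 \<le> sum_list (map2 (pick k) p e'))"
    using assms
  proof (induction n arbitrary: p e e')
    case 0
    then show ?case by (simp add: grid_0)
  next
    case (Suc n)
    obtain v q where p: "p = v # q" "q \<in> grid k n"
      using Suc.prems(1) by (auto simp: grid_Suc)
    obtain a d where e: "e = a # d" "a \<in> {1..2}" "d \<in> grid 2 n"
      using Suc.prems(2) by (auto simp: grid_Suc)
    obtain a' d' where e': "e' = a' # d'" "a' \<in> {1..2}" "d' \<in> grid 2 n"
      using Suc.prems(3) by (auto simp: grid_Suc)
    have le: "a \<le> a'" "grid_le d d'" using Suc.prems(4) e e' by auto
    note IH = Suc.IH[OF p(2) e(3) e'(3) le(2)]
    show ?case
    proof (cases "a = a'")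
      case True
      then show ?thesis using IH p e e' by simp
    next
      case False
      then have "a = 1" "a' = 2" using le e e' by auto
      then show ?thesis using IH p e e' pick_gap[of k v] by simp
    qed
  qed
  then show "sum_list (map2 (pick k) p e) \<le> sum_list (map2 (pick k) p e')"
    "e \<noteq> e' \<Longrightarrow> sum_list (map2 (pick k) p e) + k div 2 \<le> sum_list (map2 (pick k) p e')"
    by auto
qed

text \<open>An Erdos-Littlewood-Offord argument: a uniform point of the grid is obtained from a uniform \<open>p\<close>
  by choosing, independently in each coordinate, one of two values at distance at least \<open>k div 2\<close>.
  For a fixed \<open>p\<close> the choices with sum in a short window form an antichain in the Boolean lattice.\<close>

lemma window_upper:
  "card {x \<in> grid k n. a \<le> sum_list x \<and> sum_list x < a + k div 2} * 2 ^ n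
     \<le> k ^ n * (n choose (n div 2))"
proof -
  let ?W = "\<lambda>x. a \<le> sum_list x \<and> sum_list x < a + k div 2"
  have c: "card {x \<in> grid j n. Q x} = (\<Sum>x\<in>grid j n. if Q x then 1 else 0)" for j Q
    by (simp add: sum.If_cases finite_grid Int_def)
  have "card {x \<in> grid k n. ?W x} * 2 ^ n =
      (\<Sum>p\<in>grid k n. card {e \<in> grid 2 n. ?W (map2 (pick k) p e)})"
    unfolding c using sum_map2_pick[where k = k and n = n and f = "\<lambda>x. if ?W x then 1 else 0"] by (simp add: mult.commute)
  also have "\<dots> \<le> (\<Sum>p\<in>grid k n. n choose (n div 2))"
  proof (rule sum_mono)
    fix p assume p: "p \<in> grid k n"
    have "card {e \<in> grid 2 n. ?W (map2 (pick k) p e)} \<le>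
        card {x \<in> grid 2 n. sum_list x = n * (2 + 1) div 2}"
    proof (rule antichain_le_middle)
      fix e e' assume "e \<in> {e \<in> grid 2 n. ?W (map2 (pick k) p e)}"
        "e' \<in> {e \<in> grid 2 n. ?W (map2 (pick k) p e)}" "grid_le e e'"
      \<comment> \<open>Distinct comparable choices have sums at least one window length
        apart.\<close>
      then show "e = e'" using map2_pick_gap(2)[OF p, of e e'] by (auto simp del: zip_eq_Nil_iff)
    qed auto
    also have "n * (2 + 1) div 2 = n + n div 2" by simp
    finally show "card {e \<in> grid 2 n. ?W (map2 (pick k) p e)} \<le> n choose (n div 2)"
      by (simp only: card_layer_grid_2)
  qed
  finally show ?thesis by (simp add: card_grid)
qed

text \<open>Deleting the first coordinate is injective on a layer and leaves sums in
  \<open>k\<close> consecutive values, covered by three windows of length \<open>k div 2\<close>;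
  this uses \<open>k \<ge> 2\<close> and is tight for \<open>k = 3\<close>. Deleting a coordinate is
  what gives the exponent \<open>n - 1\<close>.\<close>

lemma layer_upper:
  assumes k: "k \<ge> 2" and n: "n \<ge> 1"
  shows "real (card {x \<in> grid k n. sum_list x = s}) * sqrt (real n) \<le> 3 * real k ^ (n - 1)"
proof -
  obtain m where m: "n = Suc m" using n by (cases n) auto
  define h where "h = k div 2"
  \<comment> \<open>If \<open>s < k\<close> this truncates to 0, which is harmless as the remaining
    sum is nonnegative and below \<open>k\<close>.\<close>
  define a where "a = s - k"
  have h: "k \<le> 3 * h" using k unfolding h_def by linarith
  define W where "W b = {x \<in> grid k m. b \<le> sum_list x \<and> sum_list x < b + h}" for b
  have fW: "finite (W b)" for b by (simp add: W_def finite_grid)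
  define B where "B = k ^ m * (m choose (m div 2))"
  have WB: "card (W b) * 2 ^ m \<le> B" for b
    unfolding W_def B_def h_def by (rule window_upper)
  have "card {x \<in> grid k n. sum_list x = s} \<le> card (W a \<union> W (a + h) \<union> W (a + 2 * h))"
  proof (rule card_inj_on_le[where f = tl])
    show "inj_on tl {x \<in> grid k n. sum_list x = s}"
      unfolding m by (auto simp: inj_on_def grid_Suc)
    show "tl ` {x \<in> grid k n. sum_list x = s} \<subseteq> W a \<union> W (a + h) \<union> W (a + 2 * h)"
    proof
      fix y assume "y \<in> tl ` {x \<in> grid k n. sum_list x = s}"
      then obtain v where v: "1 \<le> v" "v \<le> k" "y \<in> grid k m" "v + sum_list y = s"
        unfolding m by (auto simp: grid_Suc)
      then have "a \<le> sum_list y" "sum_list y < a + 3 * h" using h by (auto simp: a_def)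
      then show "y \<in> W a \<union> W (a + h) \<union> W (a + 2 * h)"
        using v(3) by (auto simp: W_def)
    qed
    show "finite (W a \<union> W (a + h) \<union> W (a + 2 * h))" using fW by simp
  qed
  also have "\<dots> \<le> card (W a) + card (W (a + h)) + card (W (a + 2 * h))"
    by (meson card_Un_le add_right_mono le_trans)
  finally have "card {x \<in> grid k n. sum_list x = s} * 2 ^ m \<le>
      (card (W a) + card (W (a + h)) + card (W (a + 2 * h))) * 2 ^ m"
    by (rule mult_right_mono) simp
  also have "\<dots> \<le> 3 * B" using WB[of a] WB[of "a + h"] WB[of "a + 2 * h"] by (simp add: distrib_right)
  finally have 1: "card {x \<in> grid k n. sum_list x = s} * 2 ^ m \<le> 3 * B" .
  define c where "c = m choose (m div 2)"
  have "real (c\<^sup>2 * (m + 1)) \<le> real (4 ^ m)"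
    using middle_binomial_upper[of m] unfolding c_def by (simp only: of_nat_le_iff)
  then have "sqrt ((real c)\<^sup>2 * real n) \<le> sqrt ((2 ^ m)\<^sup>2)"
    unfolding m by (intro real_sqrt_le_mono) (simp add: power2_eq_square algebra_simps flip: power_mult_distrib)
  then have 2: "real c * sqrt (real n) \<le> 2 ^ m" by (simp add: real_sqrt_mult)
  have "real (card {x \<in> grid k n. sum_list x = s}) * 2 ^ m \<le> 3 * (real k ^ m * real c)"
    using 1 unfolding B_def c_def by (simp only: of_nat_le_iff[symmetric, where 'a = real]) simp
  then have "real (card {x \<in> grid k n. sum_list x = s}) * 2 ^ m * sqrt (real n) \<le>
      3 * (real k ^ m * real c) * sqrt (real n)"
    by (rule mult_right_mono) simp
  also have "\<dots> = 3 * real k ^ m * (real c * sqrt (real n))" by simp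
  also have "\<dots> \<le> 3 * real k ^ m * 2 ^ m" using 2 by (rule mult_left_mono) simp
  finally have "(real (card {x \<in> grid k n. sum_list x = s}) * sqrt (real n)) * 2 ^ m \<le>
      (3 * real k ^ m) * 2 ^ m" by (simp add: mult_ac)
  then show ?thesis unfolding m by (simp only: mult_le_cancel_right) simp
qed

section \<open>Lower bound for the width by the second moment method\<close>

lemma card_antichain_le_width:
  assumes "finite Q" "antichain_in Q le A"
  shows "card A \<le> width Q le"
  unfolding width_def
proof (rule Max_ge)
  have "{card A |A. antichain_in Q le A} \<subseteq> card ` Pow Q" by (auto simp: antichain_in_def)
  then show "finite {card A |A. antichain_in Q le A}" using assms(1) finite_subset by blast
qed (use assms(2) in blast)

text \<open>Doubling avoids half-integers in the mean. The centred coordinates \<open>u v\<close>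
  sum to 0, which kills the cross term, and have absolute value at most \<open>k\<close>.\<close>

lemma second_moment:
  "(\<Sum>x\<in>grid k n. (2 * real (sum_list x) - real n * (real k + 1))\<^sup>2) \<le> real n * (real k)\<^sup>2 * real k ^ n"
proof (induction n)
  case 0
  then show ?case by (simp add: grid_0)
next
  case (Suc n)
  define D where "D x = 2 * real (sum_list x) - real n * (real k + 1)" for x
  define u where "u v = 2 * real v - (real k + 1)" for v :: nat
  have "(\<Sum>v=1..k. real v) = real k * (real k + 1) / 2"
    by (induction k) (auto simp: field_simps)
  then have u0: "(\<Sum>v=1..k. u v) = 0"
    by (simp add: u_def sum_subtractf flip: sum_distrib_left)
  have u2: "(\<Sum>v=1..k. (u v)\<^sup>2) \<le> real k * (real k)\<^sup>2"
  proof -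
    have "(u v)\<^sup>2 \<le> (real k)\<^sup>2" if "v \<in> {1..k}" for v
      using that by (intro power2_le_iff_abs_le[THEN iffD2]) (auto simp: u_def abs_le_iff)
    then show ?thesis using sum_bounded_above[of "{1..k}" "\<lambda>v. (u v)\<^sup>2" "(real k)\<^sup>2"] by simp
  qed
  have "2 * real (sum_list (v # x)) - real (Suc n) * (real k + 1) = u v + D x" for v x
    by (simp add: u_def D_def algebra_simps)
  then have "(\<Sum>x\<in>grid k (Suc n). (2 * real (sum_list x) - real (Suc n) * (real k + 1))\<^sup>2) =
      (\<Sum>v=1..k. \<Sum>x\<in>grid k n. (u v)\<^sup>2 + 2 * u v * D x + (D x)\<^sup>2)"
    unfolding sum_grid_Suc by (simp add: power2_sum algebra_simps)
  also have "\<dots> = (\<Sum>v=1..k. real k ^ n * (u v)\<^sup>2 + u v * (2 * (\<Sum>x\<in>grid k n. D x)) + (\<Sum>x\<in>grid k n. (D x)\<^sup>2))"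
    by (simp add: sum.distrib card_grid sum_distrib_left mult_ac)
  also have "\<dots> = real k ^ n * (\<Sum>v=1..k. (u v)\<^sup>2) + (\<Sum>v=1..k. u v) * (2 * (\<Sum>x\<in>grid k n. D x)) +
      real k * (\<Sum>x\<in>grid k n. (D x)\<^sup>2)"
    by (simp add: sum.distrib flip: sum_distrib_left sum_distrib_right)
  also have "\<dots> \<le> real k ^ n * (real k * (real k)\<^sup>2) + 0 + real k * (real n * (real k)\<^sup>2 * real k ^ n)"
    unfolding u0 using u2 Suc.IH unfolding D_def by (intro add_mono mult_left_mono) auto
  also have "\<dots> = real (Suc n) * (real k)\<^sup>2 * real k ^ Suc n" by (simp add: algebra_simps)
  finally show ?case .
qed

text \<open>The square of \<open>r\<close> is four times the second-moment bound per point, so at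
  least three quarters of the grid satisfy \<open>\<bar>D x\<bar> < r\<close>. As \<open>D\<close>
  doubles deviations, these points lie on levels spanning less than \<open>r\<close>, and each level
  is an antichain.\<close>

lemma width_lower:
  assumes k: "k \<ge> 1" and n: "n \<ge> 1"
  shows "real k ^ n \<le> 4 * real k * sqrt (real n) * real (width (grid k n) grid_le)"
proof -
  define D where "D x = 2 * real (sum_list x) - real n * (real k + 1)" for x
  define r where "r = 2 * real k * sqrt (real n)"
  have r: "r > 0" "r\<^sup>2 = 4 * (real n * (real k)\<^sup>2)" using k n by (auto simp: r_def power_mult_distrib)
  define G where "G = {x \<in> grid k n. \<bar>D x\<bar> < r}"
  have G: "G \<subseteq> grid k n" and fG: "finite G" by (auto simp: G_def finite_grid)
  have "real (card (grid k n - G)) * r\<^sup>2 \<le> (\<Sum>x\<in>grid k n - G. (D x)\<^sup>2)"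
  proof -
    have "r\<^sup>2 \<le> (D x)\<^sup>2" if "x \<in> grid k n - G" for x
      using that r(1) by (auto simp: G_def not_less power2_le_iff_abs_le abs_le_square_iff[symmetric])
    then show ?thesis using sum_bounded_below[of "grid k n - G" "r\<^sup>2" "\<lambda>x. (D x)\<^sup>2"] by simp
  qed
  also have "\<dots> \<le> (\<Sum>x\<in>grid k n. (D x)\<^sup>2)" by (intro sum_mono2 finite_grid) auto
  also have "\<dots> \<le> real n * (real k)\<^sup>2 * real k ^ n" unfolding D_def by (rule second_moment)
  also have "\<dots> = r\<^sup>2 * (real k ^ n / 4)" by (simp add: r(2))
  finally have "real (card (grid k n - G)) \<le> real k ^ n / 4"
    using r(1) by (simp add: mult.commute)
  moreover have "card (grid k n - G) + card G = k ^ n"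
    using card_Diff_subset[OF fG G] card_mono[OF finite_grid G] by (simp add: card_grid)
  then have "real (card (grid k n - G)) + real (card G) = real k ^ n"
    by (metis of_nat_add of_nat_power)
  ultimately have big: "3 / 4 * real k ^ n \<le> real (card G)" by linarith
  moreover have "real k ^ n > 0" using k by simp
  ultimately have "G \<noteq> {}" by force
  define a b where "a = Min (sum_list ` G)" and "b = Max (sum_list ` G)"
  have "a \<in> sum_list ` G" "b \<in> sum_list ` G"
    unfolding a_def b_def using fG \<open>G \<noteq> {}\<close> by (auto intro!: Min_in Max_in)
  then have ab: "real b - real a < r" by (auto simp: G_def D_def abs_less_iff)
  have "a \<le> b" unfolding a_def b_def using fG \<open>G \<noteq> {}\<close> by simp
  have "card G \<le> card {a..b} * width (grid k n) grid_le"
  proof (rule card_le_fibres[OF fG])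
    show "sum_list ` G \<subseteq> {a..b}" unfolding a_def b_def using fG by auto
    fix s
    have "card {x \<in> G. sum_list x = s} \<le> card {x \<in> grid k n. sum_list x = s}"
      using G by (intro card_mono) (auto simp: finite_grid)
    then show "card {x \<in> G. sum_list x = s} \<le> width (grid k n) grid_le"
      using card_antichain_le_width[OF finite_grid antichain_layer[of k n s]] by linarith
  qed simp
  then have "real (card G) \<le> real (card {a..b}) * real (width (grid k n) grid_le)"
    by (metis of_nat_le_iff of_nat_mult)
  also have "\<dots> \<le> 3 * real k * sqrt (real n) * real (width (grid k n) grid_le)"
  proof (rule mult_right_mono)
    \<comment> \<open>There are \<open>b - a + 1\<close> levels; absorbing the 1 turns the factor 2
      of \<open>r\<close> into 3, and dividing by \<open>3 / 4\<close> gives the constant 4.\<close>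
    have "1 \<le> real k * sqrt (real n)" using k n mult_mono[of 1 "real k" 1 "sqrt (real n)"] by simp
    then show "real (card {a..b}) \<le> 3 * real k * sqrt (real n)"
      using ab \<open>a \<le> b\<close> by (simp add: r_def of_nat_diff)
  qed simp
  finally show ?thesis using big by linarith
qed

section \<open>Products of chain decompositions\<close>

definition chain_of :: "nat \<Rightarrow> nat \<Rightarrow> nat list \<Rightarrow> nat list set" where
  "chain_of k n b = {y \<in> grid k n. chain_bottom k y = b}"

text \<open>Position in the chain counted from 0, to match the sides \<open>{..<l i}\<close> of a
  box. Elements of one chain lie on distinct levels, so comparing sums suffices.\<close>

definition chain_rank :: "nat \<Rightarrow> nat \<Rightarrow> nat list \<Rightarrow> nat list \<Rightarrow> nat" where
  "chain_rank k n b y = card {z \<in> chain_of k n b. sum_list z < sum_list y}"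

lemma finite_chain_of: "finite (chain_of k n b)"
  by (simp add: chain_of_def finite_grid)

lemma chain_rank_less:
  assumes "y \<in> chain_of k n b"
  shows "chain_rank k n b y < card (chain_of k n b)"
  unfolding chain_rank_def using assms
  by (intro psubset_card_mono finite_chain_of) blast

lemma chain_rank_le_iff:
  assumes y: "y \<in> chain_of k n b" and y': "y' \<in> chain_of k n b"
  shows "chain_rank k n b y \<le> chain_rank k n b y' \<longleftrightarrow> grid_le y y'"
proof -
  have comp: "grid_le y y' \<or> grid_le y' y"
    using y y' chain_bottom_comparable[of y k n y'] by (simp add: chain_of_def)
  have rank_less: "chain_rank k n b y < chain_rank k n b y'"
    if "sum_list y < sum_list y'" "y \<in> chain_of k n b" for y y'
    unfolding chain_rank_def
  proof (rule psubset_card_mono)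
    show "{z \<in> chain_of k n b. sum_list z < sum_list y} \<subset> {z \<in> chain_of k n b. sum_list z < sum_list y'}"
      using that by force
  qed (simp add: finite_chain_of)
  show ?thesis
  proof (cases "sum_list y" "sum_list y'" rule: linorder_cases)
    case less
    then show ?thesis using rank_less[OF less y] comp grid_le_sum_list[of y' y] by auto
  next
    case equal
    then have "y = y'" using comp grid_le_sum_list_eq by fastforce
    then show ?thesis by simp
  next
    case greater
    then show ?thesis using rank_less[OF greater y'] grid_le_sum_list[of y y'] by auto
  qed
qed

section \<open>Cutting a tuple into consecutive blocks\<close>

definition block :: "(nat \<Rightarrow> nat) \<Rightarrow> nat \<Rightarrow> 'a list \<Rightarrow> 'a list" where
  "block off j x = take (off (Suc j) - off j) (drop (off j) x)"

lemma block_in_grid: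
  assumes "x \<in> grid k n" "off (Suc j) \<le> n"
  shows "block off j x \<in> grid k (off (Suc j) - off j)"
  using assms set_take_subset[of "off (Suc j) - off j" "drop (off j) x"] set_drop_subset[of "off j" x]
  by (auto simp: grid_def block_def)

lemma grid_le_take_blocks:
  assumes "off 0 = 0" "\<And>j. j < d \<Longrightarrow> off j \<le> off (Suc j)"
    and "\<And>j. j < d \<Longrightarrow> grid_le (block off j x) (block off j y)"
  shows "grid_le (take (off d) x) (take (off d) y)"
  using assms
proof (induction d)
  case (Suc d)
  have eq: "take (off (Suc d)) z = take (off d) z @ block off d z" for z :: "nat list"
    using take_add[of "off d" "off (Suc d) - off d" z] Suc.prems(2)[of d] by (simp add: block_def)
  show ?case unfolding eq
    using Suc by (simp add: grid_le_def list_all2_appendI)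
qed simp

lemma grid_le_iff_blocks:
  assumes "off 0 = 0" "\<And>j. j < d \<Longrightarrow> off j \<le> off (Suc j)" "off d = n" "length x = n" "length y = n"
  shows "grid_le x y \<longleftrightarrow> (\<forall>j<d. grid_le (block off j x) (block off j y))"
proof
  assume "grid_le x y"
  then show "\<forall>j<d. grid_le (block off j x) (block off j y)"
    by (simp add: grid_le_def block_def list_all2_takeI list_all2_dropI)
next
  assume "\<forall>j<d. grid_le (block off j x) (block off j y)"
  then show "grid_le x y" using grid_le_take_blocks[of off d x y] assms by simp
qed

text \<open>Adds up the facets orthogonal to direction \<open>j\<close> over all boxes of a product
  decomposition: factor \<open>j\<close> contributes 1 per chain, every other factor its total
  size.\<close>

lemma sum_PiE_prod_but_one:
  fixes f :: "'i \<Rightarrow> 'b \<Rightarrow> nat"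
  assumes "finite I" "j \<in> I" "\<And>i. i \<in> I \<Longrightarrow> finite (B i)"
  shows "(\<Sum>t\<in>PiE I B. \<Prod>i\<in>I - {j}. f i (t i)) = card (B j) * (\<Prod>i\<in>I - {j}. \<Sum>b\<in>B i. f i b)"
proof -
  let ?g = "\<lambda>i b. if i = j then 1 else f i b"
  have "(\<Prod>i\<in>I - {j}. f i (t i)) = (\<Prod>i\<in>I. ?g i (t i))" for t
    by (subst prod.remove[OF assms(1,2)]) (auto intro!: prod.cong)
  then have "(\<Sum>t\<in>PiE I B. \<Prod>i\<in>I - {j}. f i (t i)) = (\<Prod>i\<in>I. \<Sum>b\<in>B i. ?g i b)"
    by (simp add: prod_sum_PiE[OF assms(1,3)])
  also have "\<dots> = card (B j) * (\<Prod>i\<in>I - {j}. \<Sum>b\<in>B i. f i b)"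
    by (subst prod.remove[OF assms(1,2)]) (auto intro!: prod.cong)
  finally show ?thesis .
qed

lemma copy_free_card_le:
  fixes X :: "'a set" and off :: "nat \<Rightarrow> nat"
  defines "m \<equiv> \<lambda>j. off (Suc j) - off j"
  assumes d: "d \<ge> 1"
    and L: "\<And>j. j < d \<Longrightarrow> bij_betw (L j) X {1..card X}"
      "\<And>p q. p \<in> X \<Longrightarrow> q \<in> X \<Longrightarrow> le p q \<longleftrightarrow> (\<forall>j<d. L j p \<le> L j q)"
    and c: "\<And>l A. A \<subseteq> PiE {..<d} (\<lambda>i. {..<l i}) \<Longrightarrow> \<not> contains_pattern X L {..<d} A \<Longrightarrow>
       card A \<le> c * (\<Sum>j<d. \<Prod>i\<in>{..<d} - {j}. l i)"
    and off: "off 0 = 0" "\<And>j. j < d \<Longrightarrow> off j \<le> off (Suc j)" "off d = n"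
    and S: "S \<subseteq> grid k n" "\<not> (\<exists>P'. is_copy X le S grid_le P')"
  shows "card S \<le> c * (\<Sum>j<d. card (chain_bottom k ` grid k (m j)) * k ^ (n - m j))"
proof -
  have off_le: "off (Suc j) \<le> n" if "j < d" for j
  proof -
    have "off i \<le> off j" if "i \<le> j" "j \<le> d" for i j
      using that
    proof (induction j rule: dec_induct)
      case (step j)
      then show ?case using off(2)[of j] by simp
    qed simp
    from this[of "Suc j" d] show ?thesis using that off(3) by simp
  qed
  define B where "B j = chain_bottom k ` grid k (m j)" for j
  have fB: "finite (B j)" for j by (simp add: B_def finite_grid)
  define \<kappa> where "\<kappa> x = (\<lambda>j\<in>{..<d}. chain_bottom k (block off j x))" for x
  define T where "T = PiE {..<d} B"
  define l where "l j b = card (chain_of k (m j) b)" for j b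
  have fS: "finite S" using S(1) finite_grid finite_subset by blast
  have blk: "block off j x \<in> grid k (m j)" if "x \<in> S" "j < d" for x j
    unfolding m_def using block_in_grid off_le that S(1) by blast
  have \<kappa>T: "\<kappa> ` S \<subseteq> T" using blk by (auto simp: \<kappa>_def T_def B_def split: if_splits)

  have fibre: "card {x \<in> S. \<kappa> x = t} \<le> c * (\<Sum>j<d. \<Prod>i\<in>{..<d} - {j}. l i (t i))" for t
  proof -
    define F where "F = {x \<in> S. \<kappa> x = t}"
    \<comment> \<open>Coordinates inside the box labelled \<open>t\<close>: the position of each
      block in its chain. This embeds the fibre as an ordered set.\<close>
    define R where "R x = (\<lambda>j\<in>{..<d}. chain_rank k (m j) (t j) (block off j x))" for x
    have ch: "block off j x \<in> chain_of k (m j) (t j)" if "x \<in> F" "j < d" for x j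
      using that blk by (auto simp: F_def \<kappa>_def chain_of_def)
    have len: "length x = n" if "x \<in> F" for x using that S(1) by (auto simp: F_def grid_def)
    have R_le: "grid_le x y \<longleftrightarrow> (\<forall>j<d. R x j \<le> R y j)" if "x \<in> F" "y \<in> F" for x y
      using grid_le_iff_blocks[of off d n x y, OF off len[OF that(1)] len[OF that(2)]]
        chain_rank_le_iff[OF ch[OF that(1)] ch[OF that(2)]] by (simp add: R_def)
    have inj: "inj_on R F"
    proof (rule inj_onI)
      fix x y assume "x \<in> F" "y \<in> F" "R x = R y"
      then have "grid_le x y" "grid_le y x" using R_le by simp_all
      then show "x = y" using grid_le_sum_list_eq grid_le_sum_list by blast
    qed
    have "\<not> contains_pattern X L {..<d} (R ` F)"
    proof
      assume "contains_pattern X L {..<d} (R ` F)"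
      then obtain f where f: "\<forall>p\<in>X. f p \<in> R ` F"
          "\<forall>j\<in>{..<d}. \<forall>p\<in>X. \<forall>q\<in>X. L j p < L j q \<longrightarrow> f p j < f q j"
        by (rule contains_patternE)
      from image_choiceE[OF f(1)] obtain g
        where g: "\<And>p. p \<in> X \<Longrightarrow> g p \<in> F" "\<And>p. p \<in> X \<Longrightarrow> f p = R (g p)" by metis
      have eq: "L j p = L j q \<Longrightarrow> p = q" if "j < d" "p \<in> X" "q \<in> X" for j p q
        using L(1)[OF that(1)] that by (auto simp: bij_betw_def dest: inj_onD)
      \<comment> \<open>Both sides are linear orders, so strict implications in both directions give
        the equivalence; ties in \<open>L j\<close> occur only for \<open>p = q\<close>.\<close>
      have L_f: "L j p \<le> L j q \<longleftrightarrow> R (g p) j \<le> R (g q) j" if "j < d" "p \<in> X" "q \<in> X" for j p q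
      proof (cases "L j p" "L j q" rule: linorder_cases)
        case less
        then have "f p j < f q j" using f(2) that by simp
        then show ?thesis using less g(2) that by simp
      next
        case equal
        then show ?thesis using eq[OF that] by simp
      next
        case greater
        then have "f q j < f p j" using f(2) that by simp
        then show ?thesis using greater g(2) that by simp
      qed
      have le_iff: "le p q \<longleftrightarrow> grid_le (g p) (g q)" if "p \<in> X" "q \<in> X" for p q
        using L(2)[OF that] L_f[OF _ that] R_le[OF g(1)[OF that(1)] g(1)[OF that(2)]] by simp
      have "inj_on g X"
      proof (rule inj_onI)
        fix p q assume pq: "p \<in> X" "q \<in> X" "g p = g q"
        \<comment> \<open>Coordinate 0 exists because \<open>d \<ge> 1\<close>.\<close>
        then have "L 0 p = L 0 q" using L_f[of 0 p q] L_f[of 0 q p] d by simp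
        then show "p = q" using eq[of 0 p q] pq d by simp
      qed
      then have "is_copy X le S grid_le (g ` X)"
        unfolding is_copy_def using g(1) le_iff
        by (intro conjI exI[of _ g]) (auto simp: F_def bij_betw_def)
      then show False using S(2) by blast
    qed
    moreover have "R ` F \<subseteq> PiE {..<d} (\<lambda>i. {..<l i (t i)})"
      using ch chain_rank_less by (auto simp: R_def l_def split: if_splits)
    ultimately have "card (R ` F) \<le> c * (\<Sum>j<d. \<Prod>i\<in>{..<d} - {j}. l i (t i))"
      by (intro c[where l = "\<lambda>i. l i (t i)"])
    then show ?thesis using card_image[OF inj] by (simp add: F_def)
  qed

  have tot: "(\<Sum>b\<in>B i. l i b) = k ^ m i" for i
  proof -
    have "(\<Sum>b\<in>B i. l i b) = card (\<Union>b\<in>B i. chain_of k (m i) b)"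
      unfolding l_def using fB finite_chain_of
      by (intro card_UN_disjoint[symmetric]) (auto simp: chain_of_def)
    also have "(\<Union>b\<in>B i. chain_of k (m i) b) = grid k (m i)"
      by (auto simp: B_def chain_of_def)
    finally show ?thesis by (simp add: card_grid)
  qed
  have total: "(\<Sum>j<d. m j) = n"
  proof -
    have "(\<Sum>j<e. m j) = off e" if "e \<le> d" for e
      using that off(2) by (induction e) (auto simp: m_def off(1) Suc_le_eq)
    then show ?thesis using off(3) by simp
  qed
  have rest: "(\<Prod>i\<in>{..<d} - {j}. k ^ m i) = k ^ (n - m j)" if "j < d" for j
  proof -
    have "(\<Sum>i\<in>{..<d} - {j}. m i) = n - m j"
      using sum.remove[of "{..<d}" j m] that total by simp
    then show ?thesis by (simp flip: power_sum)
  qed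

  have "S = (\<Union>t\<in>T. {x \<in> S. \<kappa> x = t})" using \<kappa>T by auto
  moreover have "finite T" unfolding T_def using fB by (intro finite_PiE) auto
  ultimately have "card S \<le> (\<Sum>t\<in>T. card {x \<in> S. \<kappa> x = t})"
    using card_UN_le[of T "\<lambda>t. {x \<in> S. \<kappa> x = t}"] by simp
  also have "\<dots> \<le> (\<Sum>t\<in>T. c * (\<Sum>j<d. \<Prod>i\<in>{..<d} - {j}. l i (t i)))"
    using fibre by (rule sum_mono)
  also have "\<dots> = c * (\<Sum>j<d. \<Sum>t\<in>T. \<Prod>i\<in>{..<d} - {j}. l i (t i))"
    by (simp only: sum_distrib_left[symmetric] sum.swap[of _ T])
  also have "(\<Sum>j<d. \<Sum>t\<in>T. \<Prod>i\<in>{..<d} - {j}. l i (t i)) = (\<Sum>j<d. card (B j) * k ^ (n - m j))"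
  proof (rule sum.cong[OF refl])
    fix j assume "j \<in> {..<d}"
    then show "(\<Sum>t\<in>T. \<Prod>i\<in>{..<d} - {j}. l i (t i)) = card (B j) * k ^ (n - m j)"
      unfolding T_def using sum_PiE_prod_but_one[of "{..<d}" j B l] fB tot rest by simp
  qed
  finally show ?thesis unfolding B_def .
qed

theorem theorem2:
  fixes X :: "'a set" and le :: "'a \<Rightarrow> 'a \<Rightarrow> bool"
  assumes "finite X" and "poset_on X le"
  shows "\<exists>C :: real. \<forall>k n S. k \<ge> 1 \<longrightarrow> n \<ge> 1 \<longrightarrow> n \<ge> poset_dim X le \<longrightarrow>
           S \<subseteq> grid k n \<longrightarrow> \<not> (\<exists>P'. is_copy X le S grid_le P') \<longrightarrow>
           real (card S) \<le> C * real (width (grid k n) grid_le)"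
proof -
  define d where "d = poset_dim X le"
  have d: "d \<ge> 1" and "realizer X le d"
    using poset_dim_realizer[OF assms] by (simp_all add: d_def)
  then obtain L :: "nat \<Rightarrow> 'a \<Rightarrow> nat" where "(\<forall>i<d. bij_betw (L i) X {1..card X}) \<and>
      (\<forall>p\<in>X. \<forall>q\<in>X. le p q \<longleftrightarrow> (\<forall>i<d. L i p \<le> L i q))"
    unfolding realizer_def by blast
  then have L: "\<And>i. i < d \<Longrightarrow> bij_betw (L i) X {1..card X}"
      "\<And>p q. p \<in> X \<Longrightarrow> q \<in> X \<Longrightarrow> le p q \<longleftrightarrow> (\<forall>i<d. L i p \<le> L i q)"
    by simp_all
  have "\<exists>c. \<forall>l A. A \<subseteq> PiE {..<d} (\<lambda>i. {..<l i}) \<longrightarrow> \<not> contains_pattern X L {..<d} A \<longrightarrow>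
           card A \<le> c * (\<Sum>j<d. \<Prod>i\<in>{..<d} - {j}. l i)"
    using d L(1) by (intro avoiding_box assms(1)) (auto simp: lessThan_empty_iff)
  then obtain c where c: "\<And>l A. A \<subseteq> PiE {..<d} (\<lambda>i. {..<l i}) \<Longrightarrow>
      \<not> contains_pattern X L {..<d} A \<Longrightarrow> card A \<le> c * (\<Sum>j<d. \<Prod>i\<in>{..<d} - {j}. l i)"
    by blast
  \<comment> \<open>12 is 3 from the layer bound times 4 from the width bound, \<open>d\<close>
    counts the facets, and \<open>sqrt (2 * d)\<close> comes from
    \<open>n \<le> 2 * d * m j\<close>. The final 1 makes \<open>C \<ge> 1\<close> for the case
    \<open>k = 1\<close>.\<close>
  define C where "C = 12 * real c * real d * sqrt (2 * real d) + 1"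
  have "real (card S) \<le> C * real (width (grid k n) grid_le)"
    if k: "k \<ge> 1" and n: "n \<ge> 1" "n \<ge> d" and S: "S \<subseteq> grid k n"
      "\<not> (\<exists>P'. is_copy X le S grid_le P')" for k n S
  proof -
    define w where "w = real (width (grid k n) grid_le)"
    have w0: "w \<ge> 0" by (simp add: w_def)
    have low: "real k ^ n \<le> 4 * real k * sqrt (real n) * w"
      unfolding w_def by (rule width_lower[OF k n(1)])
    show ?thesis
    proof (cases "k = 1")
      case True
      have "card S \<le> 1" using card_mono[OF finite_grid S(1)] True by (simp add: card_grid)
      moreover have "w \<noteq> 0" using low True by auto
      then have "1 \<le> w" by (simp add: w_def Suc_le_eq)
      moreover have "1 * w \<le> C * w" using w0 by (intro mult_right_mono) (simp_all add: C_def)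
      ultimately show ?thesis unfolding w_def by linarith
    next
      case False
      define q where "q = n div d"
      have q: "q \<ge> 1" using n d by (simp add: q_def div_greater_zero_iff Suc_le_eq)
      have qd: "d * q \<le> n" "n < d * q + d"
        using d dividend_less_times_div[of d n] by (simp_all add: q_def)
      \<comment> \<open>All blocks have length \<open>q\<close> except the last, which absorbs the
        remainder.\<close>
      define off where "off j = (if j < d then j * q else n)" for j
      define m where "m j = off (Suc j) - off j" for j
      have m: "q \<le> m j \<and> m j \<le> n \<and> off j \<le> off (Suc j)" if "j < d" for j
      proof (cases "Suc j < d")
        case True
        have "Suc j * q \<le> d * q" using that by (intro mult_right_mono) auto
        then have "Suc j * q \<le> n" using qd by linarith
        then show ?thesis using True that by (simp add: m_def off_def)
      next
        case False
        then have "d = Suc j" using that by simp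
        then show ?thesis using qd by (simp add: m_def off_def)
      qed
      have "card S \<le> c * (\<Sum>j<d. card (chain_bottom k ` grid k (m j)) * k ^ (n - m j))"
        unfolding m_def
        by (rule copy_free_card_le[OF d L c _ _ _ S]) (use m d in \<open>auto simp: off_def\<close>)
      then have "real (card S) \<le>
          real (c * (\<Sum>j<d. card (chain_bottom k ` grid k (m j)) * k ^ (n - m j)))"
        by (simp only: of_nat_le_iff)
      then have "real (card S) * sqrt (real n) \<le>
          real c * (\<Sum>j<d. real (card (chain_bottom k ` grid k (m j))) * real k ^ (n - m j)) * sqrt (real n)"
        by (intro mult_right_mono) simp_all
      also have "\<dots> = real c * (\<Sum>j<d. real (card (chain_bottom k ` grid k (m j))) * real k ^ (n - m j) * sqrt (real n))"
        by (simp add: sum_distrib_right mult.assoc)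
      also have "\<dots> \<le> real c * (\<Sum>j<d. 3 * sqrt (2 * real d) * real k ^ (n - 1))"
      proof (intro mult_left_mono sum_mono)
        fix j assume "j \<in> {..<d}"
        then have mj: "q \<le> m j" "m j \<le> n" "1 \<le> m j" using m q by fastforce+
        let ?N = "real (card (chain_bottom k ` grid k (m j)))"
        \<comment> \<open>The remainder is below \<open>d\<close>, and \<open>d \<le> d * q\<close>
          since \<open>q \<ge> 1\<close>.\<close>
        have "n \<le> 2 * d * q" using qd q d mult_le_mono2[OF q, of d] by linarith
        also have "\<dots> \<le> 2 * d * m j" using mj by simp
        finally have "real n \<le> 2 * real d * real (m j)"
          by (metis of_nat_le_iff of_nat_mult of_nat_numeral)
        then have sq: "sqrt (real n) \<le> sqrt (2 * real d) * sqrt (real (m j))"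
          by (simp flip: real_sqrt_mult)
        have "?N * sqrt (real (m j)) \<le>
            real (card {x \<in> grid k (m j). sum_list x = m j * (k + 1) div 2}) * sqrt (real (m j))"
          using card_chain_bottoms_le_middle by (intro mult_right_mono) auto
        also have "\<dots> \<le> 3 * real k ^ (m j - 1)"
          using k False mj by (intro layer_upper) auto
        finally have up: "?N * sqrt (real (m j)) \<le> 3 * real k ^ (m j - 1)" .
        have "?N * real k ^ (n - m j) * sqrt (real n) \<le>
            ?N * real k ^ (n - m j) * (sqrt (2 * real d) * sqrt (real (m j)))"
          using sq by (intro mult_left_mono) auto
        also have "\<dots> = (?N * sqrt (real (m j))) * (sqrt (2 * real d) * real k ^ (n - m j))"
          by (simp only: mult_ac)
        also have "\<dots> \<le> (3 * real k ^ (m j - 1)) * (sqrt (2 * real d) * real k ^ (n - m j))"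
          using up by (rule mult_right_mono) simp
        also have "\<dots> = 3 * sqrt (2 * real d) * (real k ^ (m j - 1) * real k ^ (n - m j))"
          by (simp only: mult_ac)
        also have "real k ^ (m j - 1) * real k ^ (n - m j) = real k ^ (n - 1)"
          using mj by (simp flip: power_add)
        finally show "?N * real k ^ (n - m j) * sqrt (real n) \<le> 3 * sqrt (2 * real d) * real k ^ (n - 1)" .
      qed simp
      also have "\<dots> = 3 * real c * real d * sqrt (2 * real d) * real k ^ (n - 1)" by simp
      also have "\<dots> \<le> 3 * real c * real d * sqrt (2 * real d) * (4 * sqrt (real n) * w)"
      proof (rule mult_left_mono)
        have "real k * real k ^ (n - 1) \<le> real k * (4 * sqrt (real n) * w)"
          using low n(1) by (cases n) (simp_all add: mult_ac)
        then show "real k ^ (n - 1) \<le> 4 * sqrt (real n) * w" using k by simp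
      qed simp
      also have "\<dots> = (12 * real c * real d * sqrt (2 * real d) * w) * sqrt (real n)" by simp
      finally have "real (card S) \<le> 12 * real c * real d * sqrt (2 * real d) * w"
        using n(1) by simp
      then show ?thesis using w0 by (simp add: C_def w_def distrib_right)
    qed
  qed
  then show ?thesis unfolding d_def by blast
qed

end
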